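(* Let $k$ be a negative integer, $N\ge1$ an integer, and $\chi$ a Dirichlet character modulo $N$ with $\chi(-1)=(-1)^k$. Let $\rho$ be a cusp of $\Gamma_0(N)$, let $\gamma_\rho\in\mathrm{SL}_2(\mathbb Z)$ with $\gamma_\rho(i\infty)=\rho$, let $\Gamma_\rho=\Gamma_0(N)\cap\gamma_\rho\Gamma_\infty\gamma_\rho^{-1}$, and assume that $\chi$ is trivial on $\Gamma_\rho$. Then the function $$\mathcal F_{k,\rho}(N,\chi;\tau)=\sum_{g\in\Gamma_\rho\backslash\Gamma_0(N)}\overline{\chi(g)}\left(\left.\frac{v^{1-k}}{1-k}\right|_k\gamma_\rho^{-1}g\right)(\tau)$$ belongs to $H_k^{!}(N,\chi)$ and has at most polynomial growth at any cusp of $\Gamma_0(N)$. In particular, $\mathcal F_{k,\rho}(N,\chi;\tau)\in H_k^{\#}(N,\chi)$, with shadow $$\xi_k(\mathcal F_{k,\rho}(N,\chi;\tau))=E_{2-k,\rho}(N,\overline\chi;\tau).$$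
   Context: $\tau=u+iv\in\mathbb H$, $q=e^{2\pi i\tau}$. For $\gamma=\begin{pmatrix}a&b\\c&d\end{pmatrix}\in\mathrm{GL}_2^+(\mathbb Q)$: $j(\gamma,\tau)=c\tau+d$, $(f|_k\gamma)(\tau)=(\det\gamma)^{k/2}(c\tau+d)^{-k}f(\gamma\tau)$; $v^{1-k}$ denotes the function $\tau\mapsto \mathrm{Im}(\tau)^{1-k}$. For $g=\begin{pmatrix}a&b\\c&d\end{pmatrix}\in\Gamma_0(N)$, $\chi(g)=\chi(d)$. $\Gamma_\infty$ is the stabiliser of $i\infty$ in $\mathrm{SL}_2(\mathbb Z)$. $\Delta_k=-v^2(\partial_u^2+\partial_v^2)+ikv(\partial_u+i\partial_v)$; $\xi_k(f)=2iv^k\,\overline{\partial f/\partial\bar\tau}$ is the shadow operator. $H_k^!(N,\chi)$ (harmonic Maass forms of manageable growth) is the space of smooth $f:\mathbb H\to\mathbb C$ with (i) $f|_k\gamma=\chi(d)f$ for all $\gamma\in\Gamma_0(N)$; (ii) $\Delta_kf=0$; (iii) for every $\gamma\in\mathrm{SL}_2(\mathbb Z)$, $(f|_k\gamma)(\tau)=O(e^{\epsilon v})$ as $v\to\infty$ for some $\epsilon>0$. "At most polynomial growth at any cusp" means that for every $\gamma\in\mathrm{SL}_2(\mathbb Z)$ there is $A\ge0$ with $(f|_k\gamma)(\tau)=O(v^A)$ as $v\to\infty$ uniformly in $u$; $H_k^{\#}(N,\chi)$ is the subspace of such $f\in H_k^!(N,\chi)$. The Eisenstein series of weight $2-k$ at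 $\rho$, for a character $\chi'$ modulo $N$ trivial on $\Gamma_\rho$, is $E_{2-k,\rho}(N,\chi';\tau)=\sum_{g\in\Gamma_\rho\backslash\Gamma_0(N)}\overline{\chi'(g)}\,j(\gamma_\rho^{-1}g,\tau)^{k-2}$. The series defining $\mathcal F_{k,\rho}$ converges absolutely for negative $k$. *)

theory Defs
  imports "HOL-Analysis.Analysis" "HOL-Library.Landau_Symbols"
begin

section \<open>Matrix groups and the slash operator\<close>

definition SL2Z :: "(rat^2^2) set" where
  "SL2Z = {\<gamma>. (\<forall>i j. \<gamma> $ i $ j \<in> \<int>) \<and> det \<gamma> = 1}"

definition Gamma0 :: "nat \<Rightarrow> (rat^2^2) set" where
  "Gamma0 N = {\<gamma> \<in> SL2Z. \<exists>m::int. \<gamma> $ 2 $ 1 = of_int (int N * m)}"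

definition upper_half_plane :: "complex set" where
  "upper_half_plane = {\<tau>. Im \<tau> > 0}"

definition aut_factor :: "rat^2^2 \<Rightarrow> complex \<Rightarrow> complex" where
  "aut_factor \<gamma> \<tau> = of_rat (\<gamma> $ 2 $ 1) * \<tau> + of_rat (\<gamma> $ 2 $ 2)"

definition moebius :: "rat^2^2 \<Rightarrow> complex \<Rightarrow> complex" where
  "moebius \<gamma> \<tau> =
     (of_rat (\<gamma> $ 1 $ 1) * \<tau> + of_rat (\<gamma> $ 1 $ 2)) / (of_rat (\<gamma> $ 2 $ 1) * \<tau> + of_rat (\<gamma> $ 2 $ 2))"

text \<open>Only meaningful for \<open>det \<gamma> > 0\<close> and on the upper half-plane.\<close>

definition slash :: "int \<Rightarrow> (complex \<Rightarrow> complex) \<Rightarrow> rat^2^2 \<Rightarrow> complex \<Rightarrow> complex" where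
  "slash k f \<gamma> \<tau> =
     of_real ((of_rat (det \<gamma>) :: real) powr (of_int k / 2)) * aut_factor \<gamma> \<tau> powi (- k) * f (moebius \<gamma> \<tau>)"

section \<open>Cusps\<close>

text \<open>Cusps of \<open>\<Gamma>\<^sub>0(N)\<close> are the points of the rational projective line, the same for every \<open>N\<close>.\<close>

datatype cusp = Infinity_cusp | Rat_cusp rat

fun cusp_action :: "rat^2^2 \<Rightarrow> cusp \<Rightarrow> cusp" where
  "cusp_action \<gamma> Infinity_cusp =
     (if \<gamma> $ 2 $ 1 = 0 then Infinity_cusp else Rat_cusp (\<gamma> $ 1 $ 1 / \<gamma> $ 2 $ 1))"
| "cusp_action \<gamma> (Rat_cusp x) =
     (if \<gamma> $ 2 $ 1 * x + \<gamma> $ 2 $ 2 = 0 then Infinity_cusp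
      else Rat_cusp ((\<gamma> $ 1 $ 1 * x + \<gamma> $ 1 $ 2) / (\<gamma> $ 2 $ 1 * x + \<gamma> $ 2 $ 2)))"

text \<open>The full stabiliser, so it contains minus the identity.\<close>

definition Gamma_inf :: "(rat^2^2) set" where
  "Gamma_inf = {\<gamma> \<in> SL2Z. cusp_action \<gamma> Infinity_cusp = Infinity_cusp}"

text \<open>\<open>\<Gamma>\<^sub>\<rho>\<close>, in terms of the matrix \<open>\<gamma>\<^sub>\<rho>\<close> taking the cusp at infinity to \<open>\<rho>\<close>.\<close>

definition Gamma_cusp :: "nat \<Rightarrow> rat^2^2 \<Rightarrow> (rat^2^2) set" where
  "Gamma_cusp N \<gamma>\<^sub>\<rho> = Gamma0 N \<inter> (\<lambda>h. \<gamma>\<^sub>\<rho> ** h ** matrix_inv \<gamma>\<^sub>\<rho>) ` Gamma_inf"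

section \<open>Dirichlet characters\<close>

definition dirichlet_character :: "nat \<Rightarrow> (int \<Rightarrow> complex) \<Rightarrow> bool" where
  "dirichlet_character N chi \<longleftrightarrow>
     (\<forall>m n. chi (m * n) = chi m * chi n) \<and>
     (\<forall>n. chi (n + int N) = chi n) \<and>
     (\<forall>n. chi n \<noteq> 0 \<longleftrightarrow> coprime n (int N))"

text \<open>\<open>chi(g) = chi(d)\<close>; on \<open>Gamma0 N\<close> the lower right entry is an integer and the floor just
  recovers it as an element of type \<open>int\<close>.\<close>

definition char_mat :: "(int \<Rightarrow> complex) \<Rightarrow> rat^2^2 \<Rightarrow> complex" where
  "char_mat chi g = chi \<lfloor>g $ 2 $ 2\<rfloor>"

section \<open>Differential operators\<close>

definition du :: "(complex \<Rightarrow> complex) \<Rightarrow> complex \<Rightarrow> complex" where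
  "du f \<tau> = vector_derivative (\<lambda>t::real. f (\<tau> + of_real t)) (at 0)"

definition dv :: "(complex \<Rightarrow> complex) \<Rightarrow> complex \<Rightarrow> complex" where
  "dv f \<tau> = vector_derivative (\<lambda>t::real. f (\<tau> + \<i> * of_real t)) (at 0)"

text \<open>\<open>C\<^sup>n\<close> in the real sense on an open set; \<open>differentiable\<close> is real Frechet differentiability.\<close>

fun Ck_on :: "nat \<Rightarrow> complex set \<Rightarrow> (complex \<Rightarrow> complex) \<Rightarrow> bool" where
  "Ck_on 0 S f \<longleftrightarrow> continuous_on S f"
| "Ck_on (Suc n) S f \<longleftrightarrow>
     (\<forall>\<tau>\<in>S. f differentiable (at \<tau>)) \<and> Ck_on n S (du f) \<and> Ck_on n S (dv f)"

definition smooth_on :: "complex set \<Rightarrow> (complex \<Rightarrow> complex) \<Rightarrow> bool" where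
  "smooth_on S f \<longleftrightarrow> (\<forall>n. Ck_on n S f)"

definition hyp_laplacian :: "int \<Rightarrow> (complex \<Rightarrow> complex) \<Rightarrow> complex \<Rightarrow> complex" where
  "hyp_laplacian k f \<tau> =
     - of_real ((Im \<tau>)\<^sup>2) * (du (du f) \<tau> + dv (dv f) \<tau>)
     + \<i> * of_int k * of_real (Im \<tau>) * (du f \<tau> + \<i> * dv f \<tau>)"

definition d_taubar :: "(complex \<Rightarrow> complex) \<Rightarrow> complex \<Rightarrow> complex" where
  "d_taubar f \<tau> = (du f \<tau> + \<i> * dv f \<tau>) / 2"

definition shadow :: "int \<Rightarrow> (complex \<Rightarrow> complex) \<Rightarrow> complex \<Rightarrow> complex" where
  "shadow k f \<tau> = 2 * \<i> * of_real (Im \<tau> powi k) * cnj (d_taubar f \<tau>)"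

section \<open>Harmonic Maass forms\<close>

text \<open>Functions on the upper half-plane are total functions on \<open>complex\<close> whose values elsewhere are
  irrelevant. The filter \<open>filtercomap Im at_top\<close> expresses \<open>v \<rightarrow> \<infinity>\<close> uniformly in \<open>u\<close>.\<close>

definition harmonic_maass :: "int \<Rightarrow> nat \<Rightarrow> (int \<Rightarrow> complex) \<Rightarrow> (complex \<Rightarrow> complex) set" where
  "harmonic_maass k N chi = {f.
     smooth_on upper_half_plane f \<and>
     (\<forall>\<gamma>\<in>Gamma0 N. \<forall>\<tau>\<in>upper_half_plane. slash k f \<gamma> \<tau> = char_mat chi \<gamma> * f \<tau>) \<and>
     (\<forall>\<tau>\<in>upper_half_plane. hyp_laplacian k f \<tau> = 0) \<and>
     (\<forall>\<gamma>\<in>SL2Z. \<exists>\<epsilon>>0. slash k f \<gamma> \<in> O[filtercomap Im at_top](\<lambda>\<tau>. of_real (exp (\<epsilon> * Im \<tau>))))}"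

definition poly_growth_at_cusps :: "int \<Rightarrow> (complex \<Rightarrow> complex) \<Rightarrow> bool" where
  "poly_growth_at_cusps k f \<longleftrightarrow>
     (\<forall>\<gamma>\<in>SL2Z. \<exists>A::real\<ge>0. slash k f \<gamma> \<in> O[filtercomap Im at_top](\<lambda>\<tau>. of_real (Im \<tau> powr A)))"

definition harmonic_maass_sharp :: "int \<Rightarrow> nat \<Rightarrow> (int \<Rightarrow> complex) \<Rightarrow> (complex \<Rightarrow> complex) set" where
  "harmonic_maass_sharp k N chi = {f \<in> harmonic_maass k N chi. poly_growth_at_cusps k f}"

section \<open>Sums over cosets\<close>

definition right_cosets :: "(rat^2^2) set \<Rightarrow> (rat^2^2) set \<Rightarrow> (rat^2^2) set set" where
  "right_cosets H G = (\<lambda>g. (\<lambda>h. h ** g) ` H) ` G"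

text \<open>The summands used below depend only on the coset \<open>\<Gamma>\<^sub>\<rho> g\<close> when \<open>chi\<close> is trivial on \<open>\<Gamma>\<^sub>\<rho>\<close> (which
  forces an even weight, as \<open>\<Gamma>\<^sub>\<rho>\<close> contains minus the identity), so the choice of representative is
  immaterial.\<close>

definition coset_sum ::
    "(rat^2^2) set \<Rightarrow> (rat^2^2) set \<Rightarrow> (rat^2^2 \<Rightarrow> complex) \<Rightarrow> complex" where
  "coset_sum H G t = (\<Sum>\<^sub>\<infinity>C\<in>right_cosets H G. t (SOME g. g \<in> C))"

text \<open>\<open>E\<^bsub>w,\<rho>\<^esub>(N,chi;\<tau>)\<close> for a weight \<open>w\<close>; the exponent \<open>k - 2\<close> of weight \<open>2 - k\<close> is \<open>- w\<close>.\<close>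

definition eisenstein :: "int \<Rightarrow> nat \<Rightarrow> (int \<Rightarrow> complex) \<Rightarrow> rat^2^2 \<Rightarrow> complex \<Rightarrow> complex" where
  "eisenstein w N chi \<gamma>\<^sub>\<rho> \<tau> =
     coset_sum (Gamma_cusp N \<gamma>\<^sub>\<rho>) (Gamma0 N)
       (\<lambda>g. cnj (char_mat chi g) * aut_factor (matrix_inv \<gamma>\<^sub>\<rho> ** g) \<tau> powi (- w))"

definition F_series :: "int \<Rightarrow> nat \<Rightarrow> (int \<Rightarrow> complex) \<Rightarrow> rat^2^2 \<Rightarrow> complex \<Rightarrow> complex" where
  "F_series k N chi \<gamma>\<^sub>\<rho> \<tau> =
     coset_sum (Gamma_cusp N \<gamma>\<^sub>\<rho>) (Gamma0 N)
       (\<lambda>g. cnj (char_mat chi g) *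
            slash k (\<lambda>z. of_real (Im z powi (1 - k)) / of_int (1 - k)) (matrix_inv \<gamma>\<^sub>\<rho> ** g) \<tau>)"

end

theory Submission
  imports Defs
begin

text \<open>
  Put \<open>m = - k\<close>. The seed \<open>v\<^bsup>1-k\<^esup> / (1 - k)\<close> slashed by a matrix with bottom row \<open>(c, d)\<close> is
  \<open>v\<^bsup>m+1\<^esup> J\<^bsup>-1\<^esup> J'\<^bsup>-(m+1)\<^esup> / (m + 1)\<close>, where \<open>J = c \<tau> + d\<close> and \<open>J'\<close> is its complex conjugate.
  Different cosets have different bottom rows, so \<open>F\<close> is a sum of such terms over all integer pairs
  \<open>(c, d)\<close>, weighted by coefficients of modulus at most 1 that do not depend on \<open>\<tau>\<close>. All analytic
  properties are proved for the larger family of lattice sums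
  \<open>S(p,q,r,s) = \<Sum>\<^bsub>(c,d)\<^esub> a(c,d) v\<^sup>p c\<^sup>q J\<^bsup>-r\<^esup> J'\<^bsup>-s\<^esup>\<close>.

  Smoothness. Both partial derivatives of a term are combinations of terms of the same shape, and the
  quantity \<open>w = r + s - q\<close> is preserved. Since \<open>|c| + |d|\<close> is bounded by a locally bounded multiple of
  \<open>|J|\<close>, a term is locally bounded by a multiple of \<open>(|c| + |d|)\<^bsup>-w\<^esup>\<close>, which is summable for
  \<open>w \<ge> 4\<close>. So each \<open>S\<close> with \<open>w \<ge> 4\<close> can be differentiated termwise
  (\<open>has_derivative_lattice_sum\<close>), and its derivatives are again such sums; induction on the order gives
  \<open>smooth_on_lattice_sum\<close>. For \<open>F\<close> one has \<open>w = 2 - k\<close>. The character is trivial on the stabiliser of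
  the cusp, which contains minus the identity, so \<open>k\<close> is even and \<open>2 - k \<ge> 4\<close>.

  Harmonicity and shadow. From \<open>2 i c v = J - J'\<close> there follows a linear relation between lattice sums
  (\<open>lattice_sum_relation\<close>). It collapses \<open>\<partial>\<^sub>u + i \<partial>\<^sub>v\<close> of \<open>S(m+1,0,1,m+1)\<close> to
  \<open>i (m + 1) S(m,0,0,m+2)\<close>, that is, to \<open>v\<^sup>m\<close> times an antiholomorphic series whose conjugate is the
  Eisenstein series. Similarly the Euclidean Laplacian collapses to
  \<open>(m + 1) m S(m-1,0,0,m+2)\<close>, and the two parts of \<open>\<Delta>\<^sub>k F\<close> cancel.

  Growth. By the cocycle property \<open>F|\<^sub>k\<gamma>\<close> is, for every \<open>\<gamma>\<close> in \<open>SL\<^sub>2(Z)\<close>, again such a sum. The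
  substitution \<open>(c, d) \<mapsto> (c, d + n c)\<close> moves the real part of \<open>\<tau>\<close> into \<open>[0, 1]\<close>, and this makes the
  bound uniform in \<open>u\<close> (\<open>lattice_sum_growth\<close>): \<open>F|\<^sub>k\<gamma>\<close> is \<open>O(v\<^bsup>1-k\<^esup>)\<close>.

  Modularity. Right multiplication by an element of \<open>\<Gamma>\<^sub>0(N)\<close> permutes the cosets, and a summand depends
  only on its coset (\<open>summand_left_invariant\<close>).
\<close>

section \<open>Termwise differentiation of infinite sums\<close>

text \<open>An enumeration of the index set reduces this to sequences of partial sums. Their derivatives converge
  uniformly because the tails are dominated by the tails of \<open>\<Sum> M\<close>. The factor \<open>norm h\<close> in the bound
  makes the convergence uniform in operator norm.\<close>

lemma has_derivative_infsum:
  fixes f :: "'i \<Rightarrow> 'a::real_normed_vector \<Rightarrow> 'b::banach"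
  assumes I: "countable (UNIV :: 'i set)" "infinite (UNIV :: 'i set)"
    and S: "open S" "convex S" "x \<in> S"
    and der: "\<And>i y. y \<in> S \<Longrightarrow> (f i has_derivative f' i y) (at y)"
    and bound: "\<And>i y h. y \<in> S \<Longrightarrow> norm (f' i y h) \<le> M i * norm h"
    and M: "M summable_on UNIV"
    and f: "\<And>y. y \<in> S \<Longrightarrow> (\<lambda>i. f i y) summable_on UNIV"
  shows "((\<lambda>y. \<Sum>\<^sub>\<infinity>i. f i y) has_derivative (\<lambda>h. \<Sum>\<^sub>\<infinity>i. f' i x h)) (at x)"
proof -
  obtain e :: "nat \<Rightarrow> 'i" where e: "bij_betw e UNIV UNIV"
    using bij_betw_from_nat_into[OF I] by blast
  have fsums: "(\<lambda>n. f (e n) y) sums (\<Sum>\<^sub>\<infinity>i. f i y)" if "y \<in> S" for y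
  proof -
    have "((\<lambda>n. f (e n) y) has_sum (\<Sum>\<^sub>\<infinity>i. f i y)) UNIV"
      using has_sum_infsum[OF f[OF that]]
      by (simp add: has_sum_reindex_bij_betw[OF e, of "\<lambda>i. f i y"])
    then show ?thesis by (rule has_sum_imp_sums)
  qed
  have Me: "summable (\<lambda>n. M (e n))"
  proof -
    have "(\<lambda>n. M (e n)) summable_on UNIV"
      using M by (simp add: summable_on_reindex_bij_betw[OF e, of M])
    then show ?thesis by (rule summable_on_imp_summable)
  qed
  have tail: "norm ((\<Sum>i<n. f' (e i) y h) - (\<Sum>\<^sub>\<infinity>i. f' i y h)) \<le> (\<Sum>i. M (e (i + n))) * norm h"
    if "y \<in> S" for n y h
  proof -
    have "(\<lambda>i. M i * norm h) summable_on UNIV" using M by (rule summable_on_cmult_left)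
    then have "(\<lambda>i. norm (f' i y h)) summable_on UNIV"
      by (rule summable_on_comparison_test) (use bound that in auto)
    then have "(\<lambda>i. f' i y h) summable_on UNIV" by (rule abs_summable_summable)
    then have "((\<lambda>n. f' (e n) y h) has_sum (\<Sum>\<^sub>\<infinity>i. f' i y h)) UNIV"
      using has_sum_infsum by (subst has_sum_reindex_bij_betw[OF e, of "\<lambda>i. f' i y h"])
    then have s: "(\<lambda>n. f' (e n) y h) sums (\<Sum>\<^sub>\<infinity>i. f' i y h)" by (rule has_sum_imp_sums)
    then have eq: "(\<Sum>\<^sub>\<infinity>i. f' i y h) - (\<Sum>i<n. f' (e i) y h) = (\<Sum>i. f' (e (i + n)) y h)"
      using suminf_minus_initial_segment[OF sums_summable[OF s], of n] sums_unique[OF s] by simp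
    have Ms: "summable (\<lambda>i. M (e (i + n)) * norm h)"
      by (intro summable_mult2 summable_ignore_initial_segment Me)
    have le: "norm (f' (e (i + n)) y h) \<le> M (e (i + n)) * norm h" for i
      using bound that by blast
    have "norm (\<Sum>i. f' (e (i + n)) y h) \<le> (\<Sum>i. M (e (i + n)) * norm h)"
      using norm_suminf_le[OF le Ms] by simp
    also have "\<dots> = (\<Sum>i. M (e (i + n))) * norm h"
      by (rule suminf_mult2[symmetric]) (intro summable_ignore_initial_segment Me)
    finally show ?thesis using eq by (simp add: norm_minus_commute)
  qed
  have unif: "\<forall>\<^sub>F n in sequentially. \<forall>y\<in>S. \<forall>h.
      norm (sum (\<lambda>i. f' (e i) y h) {..<n} - (\<Sum>\<^sub>\<infinity>i. f' i y h)) \<le> \<epsilon> * norm h"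
    if \<epsilon>: "\<epsilon> > 0" for \<epsilon>
  proof -
    obtain n0 where n0: "\<And>n. n \<ge> n0 \<Longrightarrow> norm (\<Sum>i. M (e (i + n))) < \<epsilon>"
      using suminf_exist_split[OF \<epsilon> Me] by blast
    show ?thesis unfolding eventually_sequentially
    proof (intro exI[of _ n0] allI impI ballI)
      fix n :: nat and y h :: "'a" assume "n0 \<le> n" "y \<in> S"
      have "(\<Sum>i. M (e (i + n))) * norm h \<le> \<epsilon> * norm h"
        using n0[OF \<open>n0 \<le> n\<close>] by (intro mult_right_mono) auto
      then show "norm (sum (\<lambda>i. f' (e i) y h) {..<n} - (\<Sum>\<^sub>\<infinity>i. f' i y h)) \<le> \<epsilon> * norm h"
        using tail[OF \<open>y \<in> S\<close>, where n = n and h = h] by linarith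
    qed
  qed
  obtain g where g: "\<And>y. y \<in> S \<Longrightarrow> (\<lambda>n. f (e n) y) sums g y"
      "\<And>y. y \<in> S \<Longrightarrow> (g has_derivative (\<lambda>h. \<Sum>\<^sub>\<infinity>i. f' i y h)) (at y within S)"
    using has_derivative_series[where f = "\<lambda>n. f (e n)" and f' = "\<lambda>n. f' (e n)"
        and g' = "\<lambda>y h. \<Sum>\<^sub>\<infinity>i. f' i y h", OF S(2) has_derivative_at_withinI[OF der] unif S(3) fsums[OF S(3)]]
    by blast
  have "g y = (\<Sum>\<^sub>\<infinity>i. f i y)" if "y \<in> S" for y
    using g(1)[OF that] fsums[OF that] sums_unique2 by blast
  moreover have "(g has_derivative (\<lambda>h. \<Sum>\<^sub>\<infinity>i. f' i x h)) (at x)"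
    using g(2)[OF S(3)] at_within_open[OF S(3,1)] by simp
  ultimately show ?thesis
    using has_derivative_transform_within_open[OF _ S(1,3)] by metis
qed

lemma has_sum_diff:
  fixes f g :: "'i \<Rightarrow> 'a::topological_ab_group_add"
  assumes "(f has_sum a) A" "(g has_sum b) A"
  shows "((\<lambda>i. f i - g i) has_sum (a - b)) A"
  using has_sum_add[OF assms(1), of "\<lambda>i. - g i" "- b"] assms(2) by (simp add: has_sum_uminus)

section \<open>Summability over the integer lattice\<close>

text \<open>The \<open>l\<^sub>1\<close> norm on the integer lattice, which measures the size of \<open>c \<tau> + d\<close> locally uniformly in \<open>\<tau>\<close>.\<close>

definition lattice_weight :: "int \<times> int \<Rightarrow> real" where
  "lattice_weight x = of_int (\<bar>fst x\<bar> + \<bar>snd x\<bar>)"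

lemma lattice_weight_pos: "x \<noteq> (0, 0) \<Longrightarrow> lattice_weight x > 0"
  by (cases x) (auto simp: lattice_weight_def)

lemma summable_on_int_inverse_square: "(\<lambda>n::int. 1 / (1 + \<bar>real_of_int n\<bar>)\<^sup>2) summable_on UNIV"
proof -
  have nat: "(\<lambda>n::nat. 1 / (1 + real n)\<^sup>2) summable_on UNIV"
  proof -
    have "summable (\<lambda>n. inverse (real (Suc n) ^ 2))"
      using inverse_power_summable[of 2, where 'a = real] by (subst summable_Suc_iff) simp
    then have "summable (\<lambda>n. norm (1 / (1 + real n)\<^sup>2))"
      by (simp add: inverse_eq_divide add.commute)
    then show ?thesis by (rule norm_summable_imp_summable_on)
  qed
  have "(\<lambda>n::int. 1 / (1 + \<bar>real_of_int n\<bar>)\<^sup>2) summable_on range int"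
    by (subst summable_on_reindex) (use nat in \<open>auto simp: o_def inj_on_def\<close>)
  moreover have "(\<lambda>n::int. 1 / (1 + \<bar>real_of_int n\<bar>)\<^sup>2) summable_on range (\<lambda>n. - int n)"
    by (subst summable_on_reindex) (use nat in \<open>auto simp: o_def inj_on_def\<close>)
  ultimately have "(\<lambda>n::int. 1 / (1 + \<bar>real_of_int n\<bar>)\<^sup>2) summable_on (range int \<union> range (\<lambda>n. - int n))"
    by (rule summable_on_union)
  moreover have "range int \<union> range (\<lambda>n. - int n) = UNIV"
  proof -
    have "n \<in> range int \<union> range (\<lambda>n. - int n)" for n
      by (cases n rule: int_cases2) auto
    then show ?thesis by blast
  qed
  ultimately show ?thesis by simp
qed

text \<open>Since \<open>(1 + |c|) (1 + |d|) \<le> 3 (|c| + |d|)\<^sup>2\<close> away from the origin, the fourth power of the weight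
  dominates a product of two squares, and the double sum factors. At the origin the inverse is \<open>0\<close>.\<close>

lemma summable_lattice_weight:
  assumes "w \<ge> 4"
  shows "(\<lambda>x. inverse (lattice_weight x) ^ w) summable_on UNIV"
proof -
  have "(\<lambda>(c::int, d::int). (1 / (1 + \<bar>real_of_int c\<bar>)\<^sup>2) * (1 / (1 + \<bar>real_of_int d\<bar>)\<^sup>2))
      summable_on UNIV \<times> UNIV"
    by (rule summable_on_SigmaI[where g = "\<lambda>c. 1 / (1 + \<bar>real_of_int c\<bar>)\<^sup>2 * (\<Sum>\<^sub>\<infinity>d::int. 1 / (1 + \<bar>real_of_int d\<bar>)\<^sup>2)"])
       (auto intro!: has_sum_cmult_right summable_on_cmult_left summable_on_int_inverse_square
          has_sum_infsum simp del: times_divide_eq_left times_divide_eq_right)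
  then have "(\<lambda>x. 9 * (\<lambda>(c::int, d::int). (1 / (1 + \<bar>real_of_int c\<bar>)\<^sup>2) * (1 / (1 + \<bar>real_of_int d\<bar>)\<^sup>2)) x)
      summable_on UNIV"
    by (intro summable_on_cmult_right) simp
  then show ?thesis
  proof (rule summable_on_comparison_test)
    fix x :: "int \<times> int"
    obtain c d where x: "x = (c, d)" by (cases x)
    define a b where "a = \<bar>real_of_int c\<bar>" and "b = \<bar>real_of_int d\<bar>"
    have n: "lattice_weight x = a + b" by (simp add: lattice_weight_def x a_def b_def)
    show "inverse (lattice_weight x) ^ w
        \<le> 9 * (\<lambda>(c, d). (1 / (1 + \<bar>real_of_int c\<bar>)\<^sup>2) * (1 / (1 + \<bar>real_of_int d\<bar>)\<^sup>2)) x"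
    proof (cases "x = (0, 0)")
      case True
      then show ?thesis using assms by (simp add: lattice_weight_def power_0_left)
    next
      case False
      have ab: "a \<ge> 0" "b \<ge> 0" by (auto simp: a_def b_def)
      have "\<bar>c\<bar> + \<bar>d\<bar> \<ge> 1" using False x by auto
      then have s: "a + b \<ge> 1" unfolding a_def b_def by linarith
      have "(1 + a) * (1 + b) \<le> 3 * (a + b)\<^sup>2"
      proof -
        have "1 \<le> (a + b)\<^sup>2" using s by (simp add: one_le_power)
        moreover have "a + b \<le> (a + b)\<^sup>2" using s by (simp add: self_le_power)
        moreover have "a * b \<le> (a + b)\<^sup>2" using ab by (simp add: power2_sum)
        ultimately show ?thesis by (simp add: algebra_simps)
      qed
      then have "((1 + a) * (1 + b))\<^sup>2 \<le> (3 * (a + b)\<^sup>2)\<^sup>2"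
        using ab by (intro power_mono) auto
      then have "((1 + a) * (1 + b))\<^sup>2 \<le> 9 * (a + b) ^ 4"
        by (simp add: power_mult_distrib flip: power_mult)
      moreover have "(a + b) ^ 4 > 0" "((1 + a) * (1 + b))\<^sup>2 > 0" using s ab by auto
      ultimately have "inverse ((a + b) ^ 4) \<le> 9 * (1 / ((1 + a) * (1 + b))\<^sup>2)"
        by (simp add: field_simps)
      moreover have "inverse (a + b) ^ w \<le> inverse (a + b) ^ 4"
        using s ab assms by (intro power_decreasing) (auto simp: inverse_le_1_iff)
      ultimately show ?thesis
        unfolding n by (simp add: x a_def b_def power_inverse power_mult_distrib)
    qed
  qed (use assms in \<open>simp add: lattice_weight_def\<close>)
qed

section \<open>Partial derivatives and real smoothness\<close>

lemma du_dv_eq: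
  assumes "(f has_derivative D) (at \<tau>)"
  shows "du f \<tau> = D 1" "dv f \<tau> = D \<i>"
proof -
  interpret D: bounded_linear D using assms by (rule has_derivative_bounded_linear)
  have line: "((\<lambda>t::real. f (\<tau> + e * of_real t)) has_vector_derivative D e) (at 0)" for e
  proof -
    have "((\<lambda>t::real. \<tau> + e * of_real t) has_derivative (\<lambda>t. t *\<^sub>R e)) (at 0)"
      by (auto intro!: derivative_eq_intros simp: scaleR_conv_of_real)
    moreover have "(f has_derivative D) (at (\<tau> + e * of_real 0))" using assms by simp
    ultimately have "((\<lambda>t::real. f (\<tau> + e * of_real t)) has_derivative (\<lambda>t. D (t *\<^sub>R e))) (at 0)"
      by (rule has_derivative_compose)
    then show ?thesis by (simp add: has_vector_derivative_def D.scaleR)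
  qed
  show "du f \<tau> = D 1" using line[of 1] by (simp add: du_def vector_derivative_at)
  show "dv f \<tau> = D \<i>" using line[of \<i>] by (simp add: dv_def vector_derivative_at)
qed

lemma du_dv_cong:
  assumes "open S" "\<tau> \<in> S" "\<And>z. z \<in> S \<Longrightarrow> f z = g z" "g differentiable (at \<tau>)"
  shows "du f \<tau> = du g \<tau>" "dv f \<tau> = dv g \<tau>"
proof -
  obtain D where g: "(g has_derivative D) (at \<tau>)" using assms(4) by (auto simp: differentiable_def)
  then have f: "(f has_derivative D) (at \<tau>)"
    by (rule has_derivative_transform_within_open[OF _ assms(1,2)]) (simp add: assms(3))
  show "du f \<tau> = du g \<tau>" "dv f \<tau> = dv g \<tau>"
    using du_dv_eq[OF f] du_dv_eq[OF g] by simp_all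
qed

lemma du_dv_add:
  assumes "f differentiable (at \<tau>)" "g differentiable (at \<tau>)"
  shows "du (\<lambda>z. f z + g z) \<tau> = du f \<tau> + du g \<tau>" "dv (\<lambda>z. f z + g z) \<tau> = dv f \<tau> + dv g \<tau>"
proof -
  obtain D E where D: "(f has_derivative D) (at \<tau>)" and E: "(g has_derivative E) (at \<tau>)"
    using assms unfolding differentiable_def by blast
  show "du (\<lambda>z. f z + g z) \<tau> = du f \<tau> + du g \<tau>" "dv (\<lambda>z. f z + g z) \<tau> = dv f \<tau> + dv g \<tau>"
    using du_dv_eq[OF D] du_dv_eq[OF E] du_dv_eq[OF has_derivative_add[OF D E]] by simp_all
qed

lemma du_dv_cmult:
  assumes "f differentiable (at \<tau>)"
  shows "du (\<lambda>z. c * f z) \<tau> = c * du f \<tau>" "dv (\<lambda>z. c * f z) \<tau> = c * dv f \<tau>"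
proof -
  obtain D where D: "(f has_derivative D) (at \<tau>)"
    using assms unfolding differentiable_def by blast
  show "du (\<lambda>z. c * f z) \<tau> = c * du f \<tau>" "dv (\<lambda>z. c * f z) \<tau> = c * dv f \<tau>"
    using du_dv_eq[OF D] du_dv_eq[OF has_derivative_mult_right[OF D, of c]] by simp_all
qed

text \<open>The partial derivatives at a point depend only on the germ of the function there, so values off the
  open set are irrelevant.\<close>

lemma Ck_on_cong:
  assumes "open S" "\<And>z. z \<in> S \<Longrightarrow> f z = g z" "Ck_on n S g"
  shows "Ck_on n S f"
  using assms(2,3)
proof (induction n arbitrary: f g)
  case 0
  then have "continuous_on S g" "\<And>z. z \<in> S \<Longrightarrow> g z = f z" by simp_all
  then have "continuous_on S f" by (rule continuous_on_eq)
  then show ?case by simp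
next
  case (Suc n)
  have g: "g differentiable (at z)" if "z \<in> S" for z using Suc.prems(2) that by simp
  have "f differentiable (at z)" if z: "z \<in> S" for z
  proof -
    obtain D where "(g has_derivative D) (at z)" using g[OF z] by (auto simp: differentiable_def)
    then have "(f has_derivative D) (at z)"
      by (rule has_derivative_transform_within_open[OF _ assms(1) z]) (simp add: Suc.prems(1))
    then show ?thesis by (auto simp: differentiable_def)
  qed
  moreover have "Ck_on n S (du f)"
    by (rule Suc.IH[of _ "du g"]) (use Suc.prems(2) du_dv_cong[OF assms(1) _ Suc.prems(1) g] in simp_all)
  moreover have "Ck_on n S (dv f)"
    by (rule Suc.IH[of _ "dv g"]) (use Suc.prems(2) du_dv_cong[OF assms(1) _ Suc.prems(1) g] in simp_all)
  ultimately show ?case by simp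
qed

lemma Ck_on_add:
  assumes "open S" "Ck_on n S f" "Ck_on n S g"
  shows "Ck_on n S (\<lambda>z. f z + g z)"
  using assms(2,3)
proof (induction n arbitrary: f g)
  case 0
  then show ?case by (simp add: continuous_on_add)
next
  case (Suc n)
  have d: "du (\<lambda>z. f z + g z) z = du f z + du g z" "dv (\<lambda>z. f z + g z) z = dv f z + dv g z"
    if "z \<in> S" for z
    using Suc.prems that by (auto intro!: du_dv_add)
  have "Ck_on n S (du (\<lambda>z. f z + g z))"
    by (rule Ck_on_cong[OF assms(1) d(1) Suc.IH]) (use Suc.prems in auto)
  moreover have "Ck_on n S (dv (\<lambda>z. f z + g z))"
    by (rule Ck_on_cong[OF assms(1) d(2) Suc.IH]) (use Suc.prems in auto)
  moreover have "(\<lambda>z. f z + g z) differentiable (at z)" if "z \<in> S" for z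
    using Suc.prems that by (intro differentiable_add) auto
  ultimately show ?case by simp
qed

lemma Ck_on_cmult:
  assumes "open S" "Ck_on n S f"
  shows "Ck_on n S (\<lambda>z. c * f z)"
  using assms(2)
proof (induction n arbitrary: f)
  case 0
  then show ?case by (simp add: continuous_on_mult)
next
  case (Suc n)
  have d: "du (\<lambda>z. c * f z) z = c * du f z" "dv (\<lambda>z. c * f z) z = c * dv f z"
    if "z \<in> S" for z
    using Suc.prems that by (auto intro!: du_dv_cmult)
  have "(\<lambda>z. c * f z) differentiable (at z)" if "z \<in> S" for z
    using Suc.prems that by (intro differentiable_mult) auto
  moreover have "Ck_on n S (du (\<lambda>z. c * f z))"
    by (rule Ck_on_cong[OF assms(1) d(1) Suc.IH]) (use Suc.prems in auto)
  moreover have "Ck_on n S (dv (\<lambda>z. c * f z))"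
    by (rule Ck_on_cong[OF assms(1) d(2) Suc.IH]) (use Suc.prems in auto)
  ultimately show ?case by simp
qed

section \<open>Terms of a lattice sum\<close>

definition lattice_form :: "int \<times> int \<Rightarrow> complex \<Rightarrow> complex" where
  "lattice_form x \<tau> = of_int (fst x) * \<tau> + of_int (snd x)"

text \<open>\<open>v\<^sup>p c\<^sup>q J\<^bsup>-r\<^esup> J'\<^bsup>-s\<^esup>\<close> for \<open>x = (c, d)\<close>. The powers of \<open>c\<close> are included because they arise from
  differentiating \<open>J\<close> and \<open>J'\<close>; with them the family is closed under \<open>\<partial>\<^sub>u\<close> and \<open>\<partial>\<^sub>v\<close>. As \<open>inverse 0 = 0\<close>,
  the pair \<open>(0, 0)\<close> contributes \<open>0\<close> whenever \<open>r + s > 0\<close> and need not be excluded from sums.\<close>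

definition lattice_term :: "nat \<Rightarrow> nat \<Rightarrow> nat \<Rightarrow> nat \<Rightarrow> int \<times> int \<Rightarrow> complex \<Rightarrow> complex" where
  "lattice_term p q r s x \<tau> = of_real (Im \<tau> ^ p) * of_int (fst x) ^ q
     * inverse (lattice_form x \<tau>) ^ r * inverse (lattice_form x (cnj \<tau>)) ^ s"

definition lattice_sum :: "(int \<times> int \<Rightarrow> complex) \<Rightarrow> nat \<Rightarrow> nat \<Rightarrow> nat \<Rightarrow> nat \<Rightarrow> complex \<Rightarrow> complex" where
  "lattice_sum a p q r s \<tau> = (\<Sum>\<^sub>\<infinity>x. a x * lattice_term p q r s x \<tau>)"

lemma cnj_lattice_form: "cnj (lattice_form x \<tau>) = lattice_form x (cnj \<tau>)"
  by (simp add: lattice_form_def)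

lemma norm_lattice_form_cnj: "norm (lattice_form x (cnj \<tau>)) = norm (lattice_form x \<tau>)"
  by (simp flip: cnj_lattice_form)

lemma lattice_form_eq_0_iff:
  assumes "Im \<tau> > 0"
  shows "lattice_form x \<tau> = 0 \<longleftrightarrow> x = (0, 0)"
proof
  assume *: "lattice_form x \<tau> = 0"
  then have "Im (lattice_form x \<tau>) = 0" by simp
  then have "fst x = 0" using assms by (simp add: lattice_form_def)
  then show "x = (0, 0)" using * by (simp add: lattice_form_def prod_eq_iff)
qed (simp add: lattice_form_def)

text \<open>The imaginary part of \<open>c \<tau> + d\<close> is \<open>c v\<close> and controls \<open>c\<close>; given that, its real part \<open>c u + d\<close>
  controls \<open>d\<close>. Only the real part of \<open>\<tau>\<close> has to be bounded, so that the estimate can also be used for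
  unbounded \<open>v\<close>.\<close>

lemma lattice_weight_le:
  assumes "Im \<tau> \<ge> \<epsilon>" "\<epsilon> > 0" "\<bar>Re \<tau>\<bar> \<le> R"
  shows "lattice_weight x \<le> (1 + (1 + R) / \<epsilon>) * norm (lattice_form x \<tau>)"
proof -
  let ?c = "real_of_int (fst x)" and ?d = "real_of_int (snd x)" and ?j = "norm (lattice_form x \<tau>)"
  have "\<bar>?c\<bar> * \<epsilon> \<le> \<bar>?c\<bar> * Im \<tau>" using assms by (intro mult_left_mono) auto
  also have "\<dots> = \<bar>Im (lattice_form x \<tau>)\<bar>" using assms by (simp add: lattice_form_def abs_mult)
  also have "\<dots> \<le> ?j" by (rule abs_Im_le_cmod)
  finally have c: "\<bar>?c\<bar> \<le> ?j / \<epsilon>" using assms by (simp add: field_simps)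
  have R: "R \<ge> 0" using assms(3) abs_ge_zero order_trans by blast
  have "?d = Re (lattice_form x \<tau>) - ?c * Re \<tau>" by (simp add: lattice_form_def)
  then have "\<bar>?d\<bar> \<le> \<bar>Re (lattice_form x \<tau>)\<bar> + \<bar>?c\<bar> * \<bar>Re \<tau>\<bar>"
    using abs_triangle_ineq4 by (simp flip: abs_mult)
  also have "\<dots> \<le> ?j + (?j / \<epsilon>) * R"
    using c assms R by (intro add_mono mult_mono abs_Re_le_cmod) auto
  finally have d: "\<bar>?d\<bar> \<le> ?j + (?j / \<epsilon>) * R" by simp
  have "lattice_weight x = \<bar>?c\<bar> + \<bar>?d\<bar>" by (simp add: lattice_weight_def)
  also have "\<dots> \<le> ?j / \<epsilon> + (?j + (?j / \<epsilon>) * R)" using c d by linarith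
  also have "\<dots> = (1 + (1 + R) / \<epsilon>) * ?j" by (simp add: algebra_simps add_divide_distrib)
  finally show ?thesis .
qed

lemma norm_lattice_term:
  "norm (lattice_term p q r s x \<tau>)
     = \<bar>Im \<tau>\<bar> ^ p * \<bar>of_int (fst x)\<bar> ^ q * inverse (norm (lattice_form x \<tau>)) ^ (r + s)"
  by (simp add: lattice_term_def norm_mult norm_power norm_inverse norm_lattice_form_cnj power_add power_abs)

text \<open>The locally uniform majorant: \<open>|c|\<close> is at most the weight, and \<open>1 / |J|\<close> is at most a constant times
  its inverse, so the excess \<open>w\<close> of denominator over numerator degree remains.\<close>

lemma norm_lattice_term_le:
  assumes \<tau>: "Im \<tau> \<ge> \<epsilon>" "\<epsilon> > 0" "norm \<tau> \<le> R"
    and w: "r + s = q + w" "w \<ge> 4"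
  shows "norm (lattice_term p q r s x \<tau>)
    \<le> R ^ p * (1 + (1 + R) / \<epsilon>) ^ (q + w) * inverse (lattice_weight x) ^ w"
proof (cases "x = (0, 0)")
  case True
  have "R \<ge> 0" using \<tau>(3) norm_ge_zero order_trans by blast
  then show ?thesis
    using w \<tau> by (simp add: norm_lattice_term True lattice_form_def lattice_weight_def power_0_left)
next
  case False
  let ?K = "1 + (1 + R) / \<epsilon>" and ?j = "norm (lattice_form x \<tau>)" and ?n = "lattice_weight x"
  have R: "R \<ge> 0" using \<tau>(3) norm_ge_zero order_trans by blast
  have K: "?K > 0" using R \<tau> by (simp add: add_pos_nonneg)
  have n: "?n > 0" by (rule lattice_weight_pos[OF False])
  have j: "?j > 0" using False \<tau> by (simp add: lattice_form_eq_0_iff)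
  have "?n \<le> ?K * ?j" 
    by (rule lattice_weight_le[OF \<tau>(1,2) order_trans[OF abs_Re_le_cmod \<tau>(3)]])
  moreover have "inverse j \<le> K * inverse n" if "n \<le> K * j" "n > 0" "K > 0" "j > 0" for n K j :: real
    using that by (simp add: field_simps)
  ultimately have jn: "inverse ?j \<le> ?K * inverse ?n" using n j K by blast
  have "norm (lattice_term p q r s x \<tau>) \<le> R ^ p * ?n ^ q * (?K * inverse ?n) ^ (q + w)"
    unfolding norm_lattice_term w
  proof (intro mult_mono power_mono jn)
    show "\<bar>Im \<tau>\<bar> \<le> R" using \<tau>(3) abs_Im_le_cmod order_trans by blast
    show "\<bar>of_int (fst x)\<bar> \<le> ?n" by (simp add: lattice_weight_def)
  qed (use R n K in auto)
  also have "\<dots> = R ^ p * ?K ^ (q + w) * (?n ^ q * inverse ?n ^ q) * inverse ?n ^ w"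
    by (simp only: power_mult_distrib power_add mult_ac)
  also have "?n ^ q * inverse ?n ^ q = 1" using n by (simp flip: power_mult_distrib)
  finally show ?thesis by simp
qed

text \<open>The real derivative is split according to \<open>v\<close>, \<open>\<tau>\<close> and the conjugate of \<open>\<tau>\<close>: the three contributions
  are proportional to \<open>Im h\<close>, \<open>h\<close> and \<open>cnj h\<close>. For \<open>p = 0\<close> the factor \<open>of_nat p\<close> removes the truncated
  exponent \<open>p - 1\<close>.\<close>

lemma has_derivative_lattice_term:
  assumes \<tau>: "Im \<tau> > 0" and rs: "r + s > 0"
  shows "(lattice_term p q r s x has_derivative
     (\<lambda>h. of_nat p * lattice_term (p - 1) q r s x \<tau> * of_real (Im h)
        - of_nat r * lattice_term p (Suc q) (Suc r) s x \<tau> * h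
        - of_nat s * lattice_term p (Suc q) r (Suc s) x \<tau> * cnj h)) (at \<tau>)"
proof (cases "x = (0, 0)")
  case True
  have "lattice_term p q r s x = (\<lambda>_. 0)" if "r + s > 0" for p q r s
    using that by (auto simp: lattice_term_def True lattice_form_def power_0_left fun_eq_iff)
  then show ?thesis using rs by simp
next
  case False
  let ?c = "of_int (fst x) :: complex"
  have j: "lattice_form x \<tau> \<noteq> 0" using False \<tau> by (simp add: lattice_form_eq_0_iff)
  then have jc: "lattice_form x (cnj \<tau>) \<noteq> 0" by (simp flip: cnj_lattice_form)
  have dv: "((\<lambda>\<tau>. of_real (Im \<tau> ^ p) :: complex) has_derivative
      (\<lambda>h. of_nat p * of_real (Im \<tau> ^ (p - 1)) * of_real (Im h))) (at \<tau>)"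
    by (auto intro!: derivative_eq_intros simp: fun_eq_iff)
  have pow: "((\<lambda>z. inverse (lattice_form x z) ^ n) has_derivative
      (\<lambda>h. - of_nat n * ?c * inverse (lattice_form x z) ^ Suc n * h)) (at z)"
    if "lattice_form x z \<noteq> 0" for z n
  proof -
    have "((\<lambda>z. inverse (lattice_form x z)) has_field_derivative
        - (inverse (lattice_form x z) * ?c * inverse (lattice_form x z))) (at z)"
      using that unfolding lattice_form_def by (auto intro!: derivative_eq_intros)
    from DERIV_power[OF this, of n] have "((\<lambda>z. inverse (lattice_form x z) ^ n) has_field_derivative
        - of_nat n * ?c * inverse (lattice_form x z) ^ Suc n) (at z)"
      by (rule DERIV_cong) (cases n; simp add: algebra_simps)
    then show ?thesis by (rule has_field_derivative_imp_has_derivative)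
  qed
  have dj: "((\<lambda>\<tau>. inverse (lattice_form x \<tau>) ^ r) has_derivative
      (\<lambda>h. - of_nat r * ?c * inverse (lattice_form x \<tau>) ^ Suc r * h)) (at \<tau>)"
    by (rule pow[OF j])
  have djc: "((\<lambda>\<tau>. inverse (lattice_form x (cnj \<tau>)) ^ s) has_derivative
      (\<lambda>h. - of_nat s * ?c * inverse (lattice_form x (cnj \<tau>)) ^ Suc s * cnj h)) (at \<tau>)"
    by (rule has_derivative_compose[OF bounded_linear_imp_has_derivative[OF bounded_linear_cnj] pow[OF jc]])
  show ?thesis
    unfolding lattice_term_def
    apply (rule has_derivative_eq_rhs)
     apply (rule has_derivative_mult[OF has_derivative_mult[OF has_derivative_mult[OF dv has_derivative_const] dj] djc])
    by (simp add: fun_eq_iff algebra_simps)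
qed

section \<open>Lattice sums: smoothness, harmonicity and growth\<close>

lemma open_upper_half_plane: "open upper_half_plane"
  unfolding upper_half_plane_def by (rule open_halfspace_Im_gt)

lemma lattice_sum_mult_Im:
  "of_real (Im \<tau>) * lattice_sum a p q r s \<tau> = lattice_sum a (Suc p) q r s \<tau>"
  unfolding lattice_sum_def
  by (subst infsum_cmult_right'[symmetric]) (simp add: lattice_term_def mult_ac)

context
  fixes a :: "int \<times> int \<Rightarrow> complex" and w :: nat
  assumes a: "\<And>x. norm (a x) \<le> 1" and w: "w \<ge> 4"
begin

lemma norm_coeff_mult_le: "norm z \<le> B \<Longrightarrow> norm (a x * z) \<le> B"
  using a[of x] mult_mono[of "norm (a x)" 1 "norm z" B] by (simp add: norm_mult)

lemma summable_lattice_sum: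
  assumes "\<tau> \<in> upper_half_plane" "r + s = q + w"
  shows "(\<lambda>x. a x * lattice_term p q r s x \<tau>) summable_on UNIV"
proof (rule abs_summable_summable, rule summable_on_comparison_test)
  show "(\<lambda>x. norm \<tau> ^ p * (1 + (1 + norm \<tau>) / Im \<tau>) ^ (q + w) * inverse (lattice_weight x) ^ w)
      summable_on UNIV"
    by (intro summable_on_cmult_right summable_lattice_weight w)
  show "norm (a x * lattice_term p q r s x \<tau>)
      \<le> norm \<tau> ^ p * (1 + (1 + norm \<tau>) / Im \<tau>) ^ (q + w) * inverse (lattice_weight x) ^ w" for x
    using assms w by (intro norm_coeff_mult_le norm_lattice_term_le) (auto simp: upper_half_plane_def)
qed auto

lemma has_sum_lattice_sum:
  assumes "\<tau> \<in> upper_half_plane" "r + s = q + w"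
  shows "((\<lambda>x. a x * lattice_term p q r s x \<tau>) has_sum lattice_sum a p q r s \<tau>) UNIV"
  unfolding lattice_sum_def by (rule has_sum_infsum[OF summable_lattice_sum[OF assms]])

text \<open>Termwise differentiation on a convex bounded neighbourhood of \<open>\<tau>\<close> that keeps away from the real line.
  The three sums in the derivative have the same \<open>w\<close> as the original one, so the same
  majorant, up to a constant, serves for all of them.\<close>

lemma has_derivative_lattice_sum:
  assumes \<tau>: "\<tau> \<in> upper_half_plane" and rs: "r + s = q + w"
  shows "(lattice_sum a p q r s has_derivative
     (\<lambda>h. of_nat p * lattice_sum a (p - 1) q r s \<tau> * of_real (Im h)
        - of_nat r * lattice_sum a p (Suc q) (Suc r) s \<tau> * h
        - of_nat s * lattice_sum a p (Suc q) r (Suc s) \<tau> * cnj h)) (at \<tau>)"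
proof -
  \<comment> \<open>On \<open>U\<close> the majorants are uniform, and convexity is what termwise differentiation needs.\<close>
  define \<epsilon> R where "\<epsilon> = Im \<tau> / 2" and "R = norm \<tau> + 1"
  define U where "U = {z. Im z > \<epsilon>} \<inter> ball 0 R"
  have \<epsilon>: "\<epsilon> > 0" using \<tau> by (simp add: \<epsilon>_def upper_half_plane_def)
  have U: "open U" "convex U" "\<tau> \<in> U"
  proof -
    show "open U" unfolding U_def by (intro open_Int open_halfspace_Im_gt open_ball)
    show "convex U" unfolding U_def by (intro convex_Int convex_halfspace_Im_gt convex_ball)
    show "\<tau> \<in> U" using \<tau> by (simp add: U_def \<epsilon>_def R_def upper_half_plane_def)
  qed
  have UH: "z \<in> upper_half_plane" if "z \<in> U" for z
    using that \<epsilon> by (auto simp: U_def upper_half_plane_def)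
  define B where "B p q = R ^ p * (1 + (1 + R) / \<epsilon>) ^ (q + w)" for p q
  define W where "W x = inverse (lattice_weight x) ^ w" for x
  have B: "norm (lattice_term p q r s x z) \<le> B p q * W x" if "z \<in> U" "r + s = q + w" for p q r s x z
    using that \<epsilon> w unfolding B_def W_def
    by (intro norm_lattice_term_le) (auto simp: U_def)
  have "R \<ge> 0" by (simp add: R_def)
  then have BW: "0 \<le> B p q * W x" for p q x
    using \<epsilon> by (simp add: B_def W_def lattice_weight_def)
  let ?f' = "\<lambda>x z h. of_nat p * lattice_term (p - 1) q r s x z * of_real (Im h)
        - of_nat r * lattice_term p (Suc q) (Suc r) s x z * h
        - of_nat s * lattice_term p (Suc q) r (Suc s) x z * cnj h"
  define K where "K = of_nat p * B (p - 1) q + of_nat r * B p (Suc q) + of_nat s * B p (Suc q)"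
  have "((\<lambda>z. \<Sum>\<^sub>\<infinity>x. a x * lattice_term p q r s x z) has_derivative (\<lambda>h. \<Sum>\<^sub>\<infinity>x. a x * ?f' x \<tau> h)) (at \<tau>)"
  proof (rule has_derivative_infsum[OF _ _ U])
    show "(\<lambda>x. K * W x) summable_on UNIV"
      unfolding W_def by (intro summable_on_cmult_right summable_lattice_weight w)
    fix z x assume z: "z \<in> U"
    show "(\<lambda>x. a x * lattice_term p q r s x z) summable_on UNIV"
      by (rule summable_lattice_sum[OF UH[OF z] rs])
    show "((\<lambda>z. a x * lattice_term p q r s x z) has_derivative (\<lambda>h. a x * ?f' x z h)) (at z)"
      using UH[OF z] rs w
      by (intro has_derivative_mult_right has_derivative_lattice_term) (auto simp: upper_half_plane_def)
    fix h :: complex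
    have "norm (?f' x z h) \<le> of_nat p * (B (p - 1) q * W x) * norm h
        + of_nat r * (B p (Suc q) * W x) * norm h + of_nat s * (B p (Suc q) * W x) * norm h"
    proof (intro order_trans[OF norm_triangle_ineq4] add_mono)
      show "norm (of_nat p * lattice_term (p - 1) q r s x z * of_real (Im h))
          \<le> of_nat p * (B (p - 1) q * W x) * norm h"
        unfolding norm_mult using B[OF z rs] abs_Im_le_cmod[of h]
        by (intro mult_mono mult_nonneg_nonneg[OF _ BW]) auto
      show "norm (of_nat r * lattice_term p (Suc q) (Suc r) s x z * h)
          \<le> of_nat r * (B p (Suc q) * W x) * norm h"
        unfolding norm_mult using B[OF z, of "Suc r" s "Suc q"] rs
        by (intro mult_mono mult_nonneg_nonneg[OF _ BW]) auto
      show "norm (of_nat s * lattice_term p (Suc q) r (Suc s) x z * cnj h)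
          \<le> of_nat s * (B p (Suc q) * W x) * norm h"
        unfolding norm_mult using B[OF z, of r "Suc s" "Suc q"] rs
        by (intro mult_mono mult_nonneg_nonneg[OF _ BW]) auto
    qed
    also have "\<dots> = K * W x * norm h" by (simp add: K_def algebra_simps)
    finally show "norm (a x * ?f' x z h) \<le> K * W x * norm h" by (rule norm_coeff_mult_le)
  qed (auto simp: finite_prod)
  moreover have "(\<Sum>\<^sub>\<infinity>x. a x * ?f' x \<tau> h) = of_nat p * lattice_sum a (p - 1) q r s \<tau> * of_real (Im h)
        - of_nat r * lattice_sum a p (Suc q) (Suc r) s \<tau> * h
        - of_nat s * lattice_sum a p (Suc q) r (Suc s) \<tau> * cnj h" for h
  proof (rule infsumI)
    have "((\<lambda>x. of_nat p * (a x * lattice_term (p - 1) q r s x \<tau>) * of_real (Im h)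
        - of_nat r * (a x * lattice_term p (Suc q) (Suc r) s x \<tau>) * h
        - of_nat s * (a x * lattice_term p (Suc q) r (Suc s) x \<tau>) * cnj h) has_sum
        (of_nat p * lattice_sum a (p - 1) q r s \<tau> * of_real (Im h)
        - of_nat r * lattice_sum a p (Suc q) (Suc r) s \<tau> * h
        - of_nat s * lattice_sum a p (Suc q) r (Suc s) \<tau> * cnj h)) UNIV"
      using \<tau> rs by (intro has_sum_diff has_sum_cmult_left has_sum_cmult_right has_sum_lattice_sum) auto
    then show "((\<lambda>x. a x * ?f' x \<tau> h) has_sum
        (of_nat p * lattice_sum a (p - 1) q r s \<tau> * of_real (Im h)
        - of_nat r * lattice_sum a p (Suc q) (Suc r) s \<tau> * h
        - of_nat s * lattice_sum a p (Suc q) r (Suc s) \<tau> * cnj h)) UNIV"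
      by (simp add: algebra_simps)
  qed
  ultimately show ?thesis by (simp add: lattice_sum_def[abs_def])
qed

lemma du_dv_lattice_sum:
  assumes "\<tau> \<in> upper_half_plane" "r + s = q + w"
  shows "du (lattice_sum a p q r s) \<tau>
      = - of_nat r * lattice_sum a p (Suc q) (Suc r) s \<tau> - of_nat s * lattice_sum a p (Suc q) r (Suc s) \<tau>"
    and "dv (lattice_sum a p q r s) \<tau>
      = of_nat p * lattice_sum a (p - 1) q r s \<tau> - \<i> * of_nat r * lattice_sum a p (Suc q) (Suc r) s \<tau>
        + \<i> * of_nat s * lattice_sum a p (Suc q) r (Suc s) \<tau>"
  using du_dv_eq[OF has_derivative_lattice_sum[OF assms]] by (simp_all add: algebra_simps)

lemma differentiable_lattice_sum:
  assumes "\<tau> \<in> upper_half_plane" "r + s = q + w"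
  shows "lattice_sum a p q r s differentiable (at \<tau>)"
  using has_derivative_lattice_sum[OF assms] by (auto simp: differentiable_def)

text \<open>The induction on the order of differentiability must treat all exponents with the given \<open>w\<close> at once,
  because differentiation changes them.\<close>

lemma smooth_on_lattice_sum:
  assumes "r + s = q + w"
  shows "smooth_on upper_half_plane (lattice_sum a p q r s)"
  unfolding smooth_on_def
proof
  fix n
  note H = open_upper_half_plane
  show "Ck_on n upper_half_plane (lattice_sum a p q r s)"
    using assms
  proof (induction n arbitrary: p q r s)
    case 0
    then show ?case
      by (auto intro!: differentiable_imp_continuous_on differentiable_at_imp_differentiable_on
          differentiable_lattice_sum)
  next
    case (Suc n)
    note comb = Ck_on_add[OF H] Ck_on_cmult[OF H] Suc.IH
    have "Ck_on n upper_half_plane (\<lambda>\<tau>. - of_nat r * lattice_sum a p (Suc q) (Suc r) s \<tau>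
        + - of_nat s * lattice_sum a p (Suc q) r (Suc s) \<tau>)"
      by (intro comb) (use Suc.prems in auto)
    then have "Ck_on n upper_half_plane (du (lattice_sum a p q r s))"
      by (rule Ck_on_cong[OF H, rotated]) (simp add: du_dv_lattice_sum[OF _ Suc.prems])
    moreover have "Ck_on n upper_half_plane (\<lambda>\<tau>. of_nat p * lattice_sum a (p - 1) q r s \<tau>
        + ((- \<i> * of_nat r) * lattice_sum a p (Suc q) (Suc r) s \<tau>
        + (\<i> * of_nat s) * lattice_sum a p (Suc q) r (Suc s) \<tau>))"
      by (intro comb) (use Suc.prems in auto)
    then have "Ck_on n upper_half_plane (dv (lattice_sum a p q r s))"
      by (rule Ck_on_cong[OF H, rotated]) (simp add: du_dv_lattice_sum[OF _ Suc.prems])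
    ultimately show ?case using differentiable_lattice_sum[OF _ Suc.prems] by simp
  qed
qed

text \<open>This is \<open>2 i c v = J - J'\<close>, multiplied by a monomial and summed.\<close>

lemma lattice_sum_relation:
  assumes \<tau>: "\<tau> \<in> upper_half_plane" and rs: "Suc (r + s) = q + w"
  shows "2 * \<i> * lattice_sum a (Suc p) (Suc q) (Suc r) (Suc s) \<tau>
    = lattice_sum a p q r (Suc s) \<tau> - lattice_sum a p q (Suc r) s \<tau>"
proof -
  have "2 * \<i> * lattice_term (Suc p) (Suc q) (Suc r) (Suc s) x \<tau>
      = lattice_term p q r (Suc s) x \<tau> - lattice_term p q (Suc r) s x \<tau>" for x
  proof (cases "x = (0, 0)")
    case True
    \<comment> \<open>Since \<open>r + s > 0\<close>, all three terms have a positive power of \<open>inverse 0\<close>.\<close>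
    then show ?thesis using rs w by (cases r; cases s) (auto simp: lattice_term_def lattice_form_def power_0_left)
  next
    case False
    define j j' where "j = lattice_form x \<tau>" and "j' = lattice_form x (cnj \<tau>)"
    have "j \<noteq> 0"
      using False \<tau> unfolding j_def by (simp add: lattice_form_eq_0_iff upper_half_plane_def)
    moreover from this have "j' \<noteq> 0" unfolding j_def j'_def by (simp flip: cnj_lattice_form)
    moreover have v: "2 * \<i> * of_real (Im \<tau>) = \<tau> - cnj \<tau>" by (simp add: complex_eq_iff)
    have "2 * \<i> * of_real (Im \<tau>) * of_int (fst x) = j - j'"
      unfolding v by (simp add: j_def j'_def lattice_form_def algebra_simps)
    ultimately have j: "2 * \<i> * of_real (Im \<tau>) * of_int (fst x) * inverse j * inverse j' = inverse j' - inverse j"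
      by (simp add: left_diff_distrib)
    define P where "P = of_real (Im \<tau> ^ p) * of_int (fst x) ^ q * inverse j ^ r * inverse j' ^ s"
    have "2 * \<i> * lattice_term (Suc p) (Suc q) (Suc r) (Suc s) x \<tau>
        = P * (2 * \<i> * of_real (Im \<tau>) * of_int (fst x) * inverse j * inverse j')"
      by (simp add: lattice_term_def P_def mult_ac flip: j_def j'_def)
    also have "\<dots> = P * inverse j' - P * inverse j" unfolding j by (rule right_diff_distrib)
    also have "\<dots> = lattice_term p q r (Suc s) x \<tau> - lattice_term p q (Suc r) s x \<tau>"
      by (simp add: lattice_term_def P_def mult_ac flip: j_def j'_def)
    finally show ?thesis .
  qed
  then have eq: "2 * \<i> * (a x * lattice_term (Suc p) (Suc q) (Suc r) (Suc s) x \<tau>)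
      = a x * lattice_term p q r (Suc s) x \<tau> - a x * lattice_term p q (Suc r) s x \<tau>" for x
    by (simp only: mult.left_commute[of _ "a x"] right_diff_distrib)
  have "((\<lambda>x. a x * lattice_term p q r (Suc s) x \<tau> - a x * lattice_term p q (Suc r) s x \<tau>) has_sum
      lattice_sum a p q r (Suc s) \<tau> - lattice_sum a p q (Suc r) s \<tau>) UNIV"
    using \<tau> rs by (intro has_sum_diff has_sum_lattice_sum) auto
  moreover have "((\<lambda>x. 2 * \<i> * (a x * lattice_term (Suc p) (Suc q) (Suc r) (Suc s) x \<tau>)) has_sum
      2 * \<i> * lattice_sum a (Suc p) (Suc q) (Suc r) (Suc s) \<tau>) UNIV"
    using \<tau> rs by (intro has_sum_cmult_right has_sum_lattice_sum) auto
  ultimately show ?thesis unfolding eq using has_sum_unique by blast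
qed

text \<open>The operator \<open>\<partial>\<^sub>u + i \<partial>\<^sub>v\<close> is twice the Wirtinger derivative in the conjugate variable, so it does not
  see \<open>J\<close>. The relation eliminates the power of \<open>c\<close> that comes from \<open>J'\<close>, and what is left is \<open>v\<^sup>m\<close>
  times an antiholomorphic sum.\<close>

lemma du_dv_maass_lattice_sum:
  assumes \<tau>: "\<tau> \<in> upper_half_plane" and m: "w = Suc (Suc m)"
  shows "du (lattice_sum a (Suc m) 0 1 (Suc m)) \<tau> + \<i> * dv (lattice_sum a (Suc m) 0 1 (Suc m)) \<tau>
    = \<i> * of_nat (Suc m) * lattice_sum a m 0 0 w \<tau>"
proof -
  have rel: "2 * \<i> * lattice_sum a (Suc m) (Suc 0) 1 (Suc (Suc m)) \<tau>
      = lattice_sum a m 0 0 (Suc (Suc m)) \<tau> - lattice_sum a m 0 1 (Suc m) \<tau>"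
    using lattice_sum_relation[OF \<tau>, of 0 "Suc m" 0 m] m by simp
  have "du (lattice_sum a (Suc m) 0 1 (Suc m)) \<tau> + \<i> * dv (lattice_sum a (Suc m) 0 1 (Suc m)) \<tau>
      = \<i> * of_nat (Suc m) * (lattice_sum a m 0 1 (Suc m) \<tau>
          + 2 * \<i> * lattice_sum a (Suc m) (Suc 0) 1 (Suc (Suc m)) \<tau>)"
    by (simp add: du_dv_lattice_sum[OF \<tau>] m algebra_simps)
  then show ?thesis by (simp only: rel m) simp
qed

text \<open>After expanding all second derivatives, the terms with two derivatives on the same linear form cancel, and two
  applications of the relation remove the remaining powers of \<open>c\<close>.\<close>

lemma laplacian_maass_lattice_sum:
  assumes \<tau>: "\<tau> \<in> upper_half_plane" and m: "w = Suc (Suc m)"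
  defines "F \<equiv> lattice_sum a (Suc m) 0 1 (Suc m)"
  shows "du (du F) \<tau> + dv (dv F) \<tau> = of_nat (Suc m) * of_nat m * lattice_sum a (m - 1) 0 0 w \<tau>"
proof -
  define p where "p = Suc m"
  have w': "w = Suc p" and m': "Suc (m - 1) = m" using m w by (auto simp: p_def)
  have one: "1 = Suc 0" by simp
  note D = du_dv_lattice_sum
  note diff = differentiable_lattice_sum
  note lin = du_dv_add du_dv_cmult differentiable_add differentiable_mult differentiable_const
  have du_F: "du F z = - 1 * lattice_sum a p 1 2 p z + - of_nat p * lattice_sum a p 1 1 (Suc p) z"
    and dv_F: "dv F z = of_nat p * lattice_sum a m 0 1 p z
      + (- \<i> * lattice_sum a p 1 2 p z + \<i> * of_nat p * lattice_sum a p 1 1 (Suc p) z)"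
    if "z \<in> upper_half_plane" for z
    using that D[of z, where p = p and q = 0 and r = 1 and s = p] by (simp_all add: F_def p_def[symmetric] w' numeral_2_eq_2) (simp add: p_def)
  have "du (du F) \<tau> = du (\<lambda>z. - 1 * lattice_sum a p 1 2 p z + - of_nat p * lattice_sum a p 1 1 (Suc p) z) \<tau>"
    by (rule du_dv_cong[OF open_upper_half_plane \<tau> du_F]) (simp_all add: lin diff \<tau> w')
  also have "\<dots> = - 1 * du (lattice_sum a p 1 2 p) \<tau> + - of_nat p * du (lattice_sum a p 1 1 (Suc p)) \<tau>"
    by (simp only: lin diff \<tau> w')
  finally have du2: "du (du F) \<tau> = \<dots>" .
  have "dv (dv F) \<tau> = dv (\<lambda>z. of_nat p * lattice_sum a m 0 1 p z
      + (- \<i> * lattice_sum a p 1 2 p z + \<i> * of_nat p * lattice_sum a p 1 1 (Suc p) z)) \<tau>"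
    by (rule du_dv_cong[OF open_upper_half_plane \<tau> dv_F]) (simp_all add: lin diff \<tau> w')
  also have "\<dots> = of_nat p * dv (lattice_sum a m 0 1 p) \<tau>
      + (- \<i> * dv (lattice_sum a p 1 2 p) \<tau> + \<i> * of_nat p * dv (lattice_sum a p 1 1 (Suc p)) \<tau>)"
    by (simp only: lin diff \<tau> w')
  finally have dv2: "dv (dv F) \<tau> = \<dots>" .
  have rel1: "2 * \<i> * lattice_sum a p 2 2 (Suc p) \<tau> = lattice_sum a m 1 1 (Suc p) \<tau> - lattice_sum a m 1 2 p \<tau>"
    using lattice_sum_relation[OF \<tau>, where p = m and q = 1 and r = 1 and s = p]
    by (simp add: w' p_def numeral_2_eq_2)
  have rel2: "2 * \<i> * lattice_sum a m 1 1 (Suc p) \<tau> = lattice_sum a (m - 1) 0 0 (Suc p) \<tau> - lattice_sum a (m - 1) 0 1 p \<tau>"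
    using lattice_sum_relation[OF \<tau>, where p = "m - 1" and q = 0 and r = 0 and s = p] m'
    by (simp add: w')
  have eqs:
    "du (lattice_sum a p 1 2 p) \<tau> = - 2 * lattice_sum a p 2 3 p \<tau> - of_nat p * lattice_sum a p 2 2 (Suc p) \<tau>"
    "du (lattice_sum a p 1 1 (Suc p)) \<tau> = - lattice_sum a p 2 2 (Suc p) \<tau> - of_nat (Suc p) * lattice_sum a p 2 1 (Suc (Suc p)) \<tau>"
    "dv (lattice_sum a m 0 1 p) \<tau> = of_nat m * lattice_sum a (m - 1) 0 1 p \<tau> - \<i> * lattice_sum a m 1 2 p \<tau>
       + \<i> * of_nat p * lattice_sum a m 1 1 (Suc p) \<tau>"
    "dv (lattice_sum a p 1 2 p) \<tau> = of_nat p * lattice_sum a m 1 2 p \<tau> - 2 * \<i> * lattice_sum a p 2 3 p \<tau>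
       + \<i> * of_nat p * lattice_sum a p 2 2 (Suc p) \<tau>"
    "dv (lattice_sum a p 1 1 (Suc p)) \<tau> = of_nat p * lattice_sum a m 1 1 (Suc p) \<tau> - \<i> * lattice_sum a p 2 2 (Suc p) \<tau>
       + \<i> * of_nat (Suc p) * lattice_sum a p 2 1 (Suc (Suc p)) \<tau>"
    by (simp_all add: D \<tau> w' numeral_2_eq_2 numeral_3_eq_3) (simp_all add: p_def)
  have "du (du F) \<tau> + dv (dv F) \<tau> = of_nat p * (of_nat m * lattice_sum a (m - 1) 0 1 p \<tau>)
      - 2 * \<i> * of_nat p * lattice_sum a m 1 2 p \<tau> + 2 * \<i> * of_nat p * of_nat p * lattice_sum a m 1 1 (Suc p) \<tau>
      - 2 * \<i> * of_nat p * (2 * \<i> * lattice_sum a p 2 2 (Suc p) \<tau>)"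
    unfolding du2 dv2 eqs by (simp add: algebra_simps)
  also have "\<dots> = of_nat p * (of_nat m * lattice_sum a (m - 1) 0 1 p \<tau>)
      + of_nat p * of_nat m * (2 * \<i> * lattice_sum a m 1 1 (Suc p) \<tau>)"
    unfolding rel1 by (simp add: p_def algebra_simps)
  also have "\<dots> = of_nat p * of_nat m * lattice_sum a (m - 1) 0 0 (Suc p) \<tau>"
    unfolding rel2 by (simp add: algebra_simps)
  finally show ?thesis by (simp add: p_def w')
qed

text \<open>The lattice is invariant under the shear \<open>(c, d) \<mapsto> (c, d + n c)\<close>, which replaces \<open>\<tau>\<close> by \<open>\<tau> - n\<close>. With
  \<open>n\<close> the integer part of \<open>u\<close>, the comparison between \<open>|c \<tau> + d|\<close> and the weight of the sheared pair
  has the absolute constant 3 for all \<open>v \<ge> 1\<close>, and the sum of the weights does not change.\<close>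

lemma lattice_sum_growth:
  assumes rs: "r + s = w"
  shows "\<exists>M. \<forall>\<tau>. Im \<tau> \<ge> 1 \<longrightarrow> norm (lattice_sum a p 0 r s \<tau>) \<le> M * Im \<tau> ^ p"
proof (intro exI allI impI)
  fix \<tau> :: complex assume \<tau>: "Im \<tau> \<ge> 1"
  define n where "n = \<lfloor>Re \<tau>\<rfloor>"
  define shift where "shift x = (fst x, snd x + n * fst x)" for x :: "int \<times> int"
  define W where "W x = inverse (lattice_weight x) ^ w" for x
  have shift: "bij_betw shift UNIV UNIV"
    by (rule bij_betwI[of _ _ _ "\<lambda>x. (fst x, snd x - n * fst x)"]) (auto simp: shift_def)
  have W: "W summable_on UNIV" unfolding W_def by (rule summable_lattice_weight[OF w])
  have W': "(\<lambda>x. W (shift x)) summable_on UNIV"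
    using W by (simp add: summable_on_reindex_bij_betw[OF shift, of W])
  have le: "norm (a x * lattice_term p 0 r s x \<tau>) \<le> 3 ^ w * Im \<tau> ^ p * W (shift x)" for x
  proof (rule norm_coeff_mult_le)
    have j: "lattice_form x \<tau> = lattice_form (shift x) (\<tau> - of_int n)"
      by (simp add: lattice_form_def shift_def algebra_simps)
    have "0 \<le> Re \<tau> - of_int n" "Re \<tau> - of_int n \<le> 1"
      unfolding n_def by linarith+
    then have "lattice_weight (shift x) \<le> 3 * norm (lattice_form x \<tau>)"
      using \<tau> lattice_weight_le[of 1 "\<tau> - of_int n" 1 "shift x"] by (simp add: j)
    show "norm (lattice_term p 0 r s x \<tau>) \<le> 3 ^ w * Im \<tau> ^ p * W (shift x)"
    proof (cases "x = (0, 0)")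
      case True
      then show ?thesis using \<tau> w by (simp add: norm_lattice_term rs lattice_form_def power_0_left W_def shift_def lattice_weight_def)
    next
      case False
      then have "shift x \<noteq> (0, 0)" by (auto simp: shift_def prod_eq_iff)
      then have pos: "norm (lattice_form x \<tau>) > 0" "lattice_weight (shift x) > 0"
        using \<tau> False by (simp_all add: lattice_form_eq_0_iff lattice_weight_pos)
      have "inverse (norm (lattice_form x \<tau>)) \<le> 3 * inverse (lattice_weight (shift x))"
        using pos \<open>lattice_weight (shift x) \<le> _\<close> by (simp add: field_simps)
      then have "inverse (norm (lattice_form x \<tau>)) ^ w \<le> (3 * inverse (lattice_weight (shift x))) ^ w"
        by (intro power_mono) simp_all
      then have "Im \<tau> ^ p * inverse (norm (lattice_form x \<tau>)) ^ w \<le> Im \<tau> ^ p * (3 ^ w * W (shift x))"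
        using \<tau> by (intro mult_left_mono) (simp_all add: W_def power_mult_distrib)
      then show ?thesis using \<tau> by (simp add: norm_lattice_term rs mult_ac)
    qed
  qed
  have "norm (lattice_sum a p 0 r s \<tau>) \<le> (\<Sum>\<^sub>\<infinity>x. 3 ^ w * Im \<tau> ^ p * W (shift x))"
    unfolding lattice_sum_def
  proof (rule norm_infsum_le[OF has_sum_infsum has_sum_infsum])
    show "(\<lambda>x. a x * lattice_term p 0 r s x \<tau>) summable_on UNIV"
      using \<tau> rs by (intro summable_lattice_sum) (auto simp: upper_half_plane_def)
    show "(\<lambda>x. 3 ^ w * Im \<tau> ^ p * W (shift x)) summable_on UNIV"
      by (rule summable_on_cmult_right[OF W'])
  qed (rule le)
  also have "\<dots> = 3 ^ w * Im \<tau> ^ p * (\<Sum>\<^sub>\<infinity>x. W x)"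
    by (simp add: infsum_cmult_right' infsum_reindex_bij_betw[OF shift, of W])
  finally show "norm (lattice_sum a p 0 r s \<tau>) \<le> 3 ^ w * (\<Sum>\<^sub>\<infinity>x. inverse (lattice_weight x) ^ w) * Im \<tau> ^ p"
    by (simp add: W_def mult_ac)
qed

end

section \<open>The groups and their cosets\<close>

lemma matrix_mult_2: "(A ** B) $ i $ j = A $ i $ 1 * B $ 1 $ j + A $ i $ 2 * B $ 2 $ j"
  for A B :: "'a::semiring_1^2^2"
  by (simp add: matrix_matrix_mult_def sum_2)

lemma SL2Z_det: "A \<in> SL2Z \<Longrightarrow> A $ 1 $ 1 * A $ 2 $ 2 - A $ 1 $ 2 * A $ 2 $ 1 = 1"
  by (simp add: SL2Z_def det_2)

lemma SL2Z_Ints: "A \<in> SL2Z \<Longrightarrow> A $ i $ j \<in> \<int>"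
  by (simp add: SL2Z_def)

lemma SL2Z_mult: "A \<in> SL2Z \<Longrightarrow> B \<in> SL2Z \<Longrightarrow> A ** B \<in> SL2Z"
  by (simp add: SL2Z_def matrix_mult_2 det_mul)

lemma SL2Z_matrix_inv:
  assumes "A \<in> SL2Z"
  shows "matrix_inv A ** A = mat 1" "A ** matrix_inv A = mat 1" "matrix_inv A \<in> SL2Z"
    "matrix_inv A $ 1 $ 1 = A $ 2 $ 2" "matrix_inv A $ 1 $ 2 = - A $ 1 $ 2"
    "matrix_inv A $ 2 $ 1 = - A $ 2 $ 1" "matrix_inv A $ 2 $ 2 = A $ 1 $ 1"
proof -
  define B :: "rat^2^2" where "B = vector [vector [A $ 2 $ 2, - A $ 1 $ 2], vector [- A $ 2 $ 1, A $ 1 $ 1]]"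
  have B: "B $ 1 $ 1 = A $ 2 $ 2" "B $ 1 $ 2 = - A $ 1 $ 2" "B $ 2 $ 1 = - A $ 2 $ 1" "B $ 2 $ 2 = A $ 1 $ 1"
    by (simp_all add: B_def)
  have AB: "A ** B = mat 1" "B ** A = mat 1"
    using SL2Z_det[OF assms] by (simp_all add: vec_eq_iff forall_2 matrix_mult_2 B mat_def algebra_simps)
  have "A ** matrix_inv A = mat 1 \<and> matrix_inv A ** A = mat 1"
    unfolding matrix_inv_def by (rule someI[of _ B]) (simp add: AB)
  then show inv: "matrix_inv A ** A = mat 1" "A ** matrix_inv A = mat 1" by simp_all
  have "matrix_inv A = B"
    by (metis AB(1) inv(1) matrix_mul_assoc matrix_mul_lid matrix_mul_rid)
  then show "matrix_inv A $ 1 $ 1 = A $ 2 $ 2" "matrix_inv A $ 1 $ 2 = - A $ 1 $ 2"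
    "matrix_inv A $ 2 $ 1 = - A $ 2 $ 1" "matrix_inv A $ 2 $ 2 = A $ 1 $ 1"
    by (simp_all add: B)
  show "matrix_inv A \<in> SL2Z"
    using assms \<open>matrix_inv A = B\<close> SL2Z_det[OF assms]
    by (simp add: SL2Z_def forall_2 B det_2 algebra_simps)
qed

lemma SL2Z_cancel:
  assumes "A \<in> SL2Z"
  shows "matrix_inv A ** (A ** B) = B" "A ** (matrix_inv A ** B) = B"
  by (simp_all add: matrix_mul_assoc SL2Z_matrix_inv[OF assms])

lemma SL2Z_solve_right:
  assumes "A \<in> SL2Z" "B ** A = C"
  shows "B = C ** matrix_inv A"
  using SL2Z_matrix_inv(2)[OF assms(1)] by (simp add: assms(2)[symmetric] flip: matrix_mul_assoc)

lemma Gamma0_SL2Z: "A \<in> Gamma0 N \<Longrightarrow> A \<in> SL2Z"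
  by (simp add: Gamma0_def)

lemma Gamma0_lower_left: "A \<in> Gamma0 N \<Longrightarrow> \<exists>m. A $ 2 $ 1 = of_int (int N * m)"
  by (simp add: Gamma0_def)

lemma Gamma0_mult:
  assumes "A \<in> Gamma0 N" "B \<in> Gamma0 N"
  shows "A ** B \<in> Gamma0 N"
proof -
  obtain m n where mn: "A $ 2 $ 1 = of_int (int N * m)" "B $ 2 $ 1 = of_int (int N * n)"
    using assms Gamma0_lower_left by blast
  obtain b d where bd: "B $ 1 $ 1 = of_int b" "A $ 2 $ 2 = of_int d"
    using SL2Z_Ints[OF Gamma0_SL2Z] assms by (metis Ints_cases)
  have "(A ** B) $ 2 $ 1 = of_int (int N * (m * b + d * n))"
    by (simp add: matrix_mult_2 mn bd algebra_simps)
  then show ?thesis using assms SL2Z_mult unfolding Gamma0_def by blast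
qed

lemma Gamma0_matrix_inv:
  assumes "A \<in> Gamma0 N"
  shows "matrix_inv A \<in> Gamma0 N"
proof -
  obtain m where m: "A $ 2 $ 1 = of_int (int N * m)" using assms Gamma0_lower_left by blast
  have "matrix_inv A $ 2 $ 1 = of_int (int N * (- m))"
    using SL2Z_matrix_inv(6)[OF Gamma0_SL2Z[OF assms]] m by simp
  then show ?thesis using SL2Z_matrix_inv(3)[OF Gamma0_SL2Z[OF assms]] unfolding Gamma0_def by blast
qed

lemma mat_in_Gamma0: "mat 1 \<in> Gamma0 N" "mat (-1) \<in> Gamma0 N"
  by (auto simp: Gamma0_def SL2Z_def forall_2 mat_def det_2 intro!: exI[of _ 0])

text \<open>Conjugation by \<open>\<rho>\<close> turns fixing the cusp into being upper triangular. In this form the group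
  properties are immediate.\<close>

lemma Gamma_cusp_iff:
  assumes "\<rho> \<in> SL2Z"
  shows "g \<in> Gamma_cusp N \<rho> \<longleftrightarrow> g \<in> Gamma0 N \<and> (matrix_inv \<rho> ** g ** \<rho>) $ 2 $ 1 = 0"
proof -
  have inf: "h \<in> Gamma_inf \<longleftrightarrow> h \<in> SL2Z \<and> h $ 2 $ 1 = 0" for h
    by (simp add: Gamma_inf_def)
  have "g \<in> (\<lambda>h. \<rho> ** h ** matrix_inv \<rho>) ` Gamma_inf \<longleftrightarrow> (matrix_inv \<rho> ** g ** \<rho>) $ 2 $ 1 = 0"
    if g: "g \<in> Gamma0 N"
  proof
    assume "g \<in> (\<lambda>h. \<rho> ** h ** matrix_inv \<rho>) ` Gamma_inf"
    then obtain h where "h \<in> Gamma_inf" "g = \<rho> ** h ** matrix_inv \<rho>" by blast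
    moreover from this have "matrix_inv \<rho> ** g ** \<rho> = h"
      using assms by (simp add: SL2Z_cancel SL2Z_matrix_inv flip: matrix_mul_assoc)
    ultimately show "(matrix_inv \<rho> ** g ** \<rho>) $ 2 $ 1 = 0" by (simp add: inf)
  next
    assume "(matrix_inv \<rho> ** g ** \<rho>) $ 2 $ 1 = 0"
    then have "matrix_inv \<rho> ** g ** \<rho> \<in> Gamma_inf"
      using assms g by (simp add: inf SL2Z_mult SL2Z_matrix_inv Gamma0_SL2Z)
    moreover have "g = \<rho> ** (matrix_inv \<rho> ** g ** \<rho>) ** matrix_inv \<rho>"
      using assms by (simp add: SL2Z_cancel SL2Z_matrix_inv flip: matrix_mul_assoc)
    ultimately show "g \<in> (\<lambda>h. \<rho> ** h ** matrix_inv \<rho>) ` Gamma_inf" by blast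
  qed
  then show ?thesis unfolding Gamma_cusp_def by blast
qed

lemma Gamma_cusp_mult:
  assumes \<rho>: "\<rho> \<in> SL2Z" and "g \<in> Gamma_cusp N \<rho>" "h \<in> Gamma_cusp N \<rho>"
  shows "g ** h \<in> Gamma_cusp N \<rho>"
proof -
  have "matrix_inv \<rho> ** (g ** h) ** \<rho> = (matrix_inv \<rho> ** g ** \<rho>) ** (matrix_inv \<rho> ** h ** \<rho>)"
    using \<rho> by (simp add: SL2Z_cancel flip: matrix_mul_assoc)
  then show ?thesis
    using assms by (simp add: Gamma_cusp_iff Gamma0_mult) (simp add: matrix_mult_2)
qed

lemma Gamma_cusp_matrix_inv:
  assumes \<rho>: "\<rho> \<in> SL2Z" and g: "g \<in> Gamma_cusp N \<rho>"
  shows "matrix_inv g \<in> Gamma_cusp N \<rho>"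
proof -
  have g': "g \<in> SL2Z" "g \<in> Gamma0 N" using assms by (auto simp: Gamma_cusp_iff Gamma0_SL2Z)
  let ?h = "matrix_inv \<rho> ** g ** \<rho>"
  have h: "?h \<in> SL2Z" "?h $ 2 $ 1 = 0" using assms g' by (simp_all add: Gamma_cusp_iff SL2Z_mult SL2Z_matrix_inv)
  have "(matrix_inv \<rho> ** matrix_inv g ** \<rho>) ** ?h = mat 1"
    using \<rho> g' by (simp add: SL2Z_cancel SL2Z_matrix_inv flip: matrix_mul_assoc)
  from SL2Z_solve_right[OF h(1) this] have "matrix_inv \<rho> ** matrix_inv g ** \<rho> = matrix_inv ?h"
    by (simp only: matrix_mul_lid)
  then show ?thesis
    using \<rho> g' h by (simp add: Gamma_cusp_iff Gamma0_matrix_inv SL2Z_matrix_inv)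
qed

lemma mat_in_Gamma_cusp:
  assumes "\<rho> \<in> SL2Z"
  shows "mat 1 \<in> Gamma_cusp N \<rho>" "mat (-1) \<in> Gamma_cusp N \<rho>"
  using mat_in_Gamma0[of N]
  by (simp_all add: Gamma_cusp_iff[OF assms] matrix_mult_2 SL2Z_matrix_inv[OF assms])
     (simp_all add: mat_def)

lemma Gamma_cusp_Gamma0: "g \<in> Gamma_cusp N \<rho> \<Longrightarrow> g \<in> Gamma0 N"
  by (simp add: Gamma_cusp_def)

text \<open>The same choice as in \<open>coset_sum\<close>.\<close>

definition coset_rep :: "(rat^2^2) set \<Rightarrow> rat^2^2" where
  "coset_rep C = (SOME g. g \<in> C)"

lemma coset_eq_iff:
  assumes \<rho>: "\<rho> \<in> SL2Z" and g: "g \<in> Gamma0 N" "g' \<in> Gamma0 N"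
  shows "(\<lambda>h. h ** g) ` Gamma_cusp N \<rho> = (\<lambda>h. h ** g') ` Gamma_cusp N \<rho>
    \<longleftrightarrow> (\<exists>h\<in>Gamma_cusp N \<rho>. g' = h ** g)"
proof
  assume "(\<lambda>h. h ** g) ` Gamma_cusp N \<rho> = (\<lambda>h. h ** g') ` Gamma_cusp N \<rho>"
  moreover have "g' \<in> (\<lambda>h. h ** g') ` Gamma_cusp N \<rho>"
    using mat_in_Gamma_cusp(1)[OF \<rho>] by (metis image_eqI matrix_mul_lid)
  ultimately show "\<exists>h\<in>Gamma_cusp N \<rho>. g' = h ** g" by blast
next
  assume "\<exists>h\<in>Gamma_cusp N \<rho>. g' = h ** g"
  then obtain h where h: "h \<in> Gamma_cusp N \<rho>" "g' = h ** g" by blast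
  have hinv: "h \<in> SL2Z" using h Gamma_cusp_Gamma0 Gamma0_SL2Z by blast
  show "(\<lambda>h. h ** g) ` Gamma_cusp N \<rho> = (\<lambda>h. h ** g') ` Gamma_cusp N \<rho>"
  proof (intro equalityI image_subsetI)
    fix x assume x: "x \<in> Gamma_cusp N \<rho>"
    have "x ** g = (x ** matrix_inv h) ** g'"
      using hinv by (simp add: h SL2Z_cancel flip: matrix_mul_assoc)
    then show "x ** g \<in> (\<lambda>h. h ** g') ` Gamma_cusp N \<rho>"
      using Gamma_cusp_mult[OF \<rho> x Gamma_cusp_matrix_inv[OF \<rho> h(1)]] by blast
    have "x ** g' = (x ** h) ** g" by (simp add: h matrix_mul_assoc)
    then show "x ** g' \<in> (\<lambda>h. h ** g) ` Gamma_cusp N \<rho>"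
      using Gamma_cusp_mult[OF \<rho> x h(1)] by blast
  qed
qed

lemma coset_rep:
  assumes \<rho>: "\<rho> \<in> SL2Z" and C: "C \<in> right_cosets (Gamma_cusp N \<rho>) (Gamma0 N)"
  shows "coset_rep C \<in> Gamma0 N" "C = (\<lambda>h. h ** coset_rep C) ` Gamma_cusp N \<rho>"
proof -
  obtain g where g: "g \<in> Gamma0 N" "C = (\<lambda>h. h ** g) ` Gamma_cusp N \<rho>"
    using C by (auto simp: right_cosets_def)
  have "mat 1 ** g \<in> C" unfolding g(2) by (rule imageI[OF mat_in_Gamma_cusp(1)[OF \<rho>]])
  then have "coset_rep C \<in> C" unfolding coset_rep_def by (rule someI)
  moreover have "\<exists>h\<in>Gamma_cusp N \<rho>. x = h ** g" if "x \<in> C" for x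
    using that unfolding g(2) by blast
  ultimately obtain h where h: "h \<in> Gamma_cusp N \<rho>" "coset_rep C = h ** g" by blast
  show rep: "coset_rep C \<in> Gamma0 N"
    unfolding h(2) by (rule Gamma0_mult[OF Gamma_cusp_Gamma0[OF h(1)] g(1)])
  have "(\<lambda>h. h ** g) ` Gamma_cusp N \<rho> = (\<lambda>h. h ** coset_rep C) ` Gamma_cusp N \<rho>"
    using coset_eq_iff[OF \<rho> g(1) rep] h by blast
  with g(2) show "C = (\<lambda>h. h ** coset_rep C) ` Gamma_cusp N \<rho>" by (rule trans)
qed

lemma coset_eqI:
  assumes \<rho>: "\<rho> \<in> SL2Z"
    and C: "C \<in> right_cosets (Gamma_cusp N \<rho>) (Gamma0 N)" "D \<in> right_cosets (Gamma_cusp N \<rho>) (Gamma0 N)"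
    and h: "h \<in> Gamma_cusp N \<rho>" "coset_rep D = h ** coset_rep C"
  shows "C = D"
proof -
  have "(\<lambda>h. h ** coset_rep C) ` Gamma_cusp N \<rho> = (\<lambda>h. h ** coset_rep D) ` Gamma_cusp N \<rho>"
    using coset_eq_iff[OF \<rho> coset_rep(1)[OF \<rho> C(1)] coset_rep(1)[OF \<rho> C(2)]] h by blast
  then show ?thesis
    by (rule trans[OF coset_rep(2)[OF \<rho> C(1)] trans[OF _ coset_rep(2)[OF \<rho> C(2), symmetric]]])
qed

definition bottom_row :: "rat^2^2 \<Rightarrow> int \<times> int" where
  "bottom_row A = (\<lfloor>A $ 2 $ 1\<rfloor>, \<lfloor>A $ 2 $ 2\<rfloor>)"

lemma bottom_row_entries:
  assumes "A \<in> SL2Z"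
  shows "A $ 2 $ 1 = of_int (fst (bottom_row A))" "A $ 2 $ 2 = of_int (snd (bottom_row A))"
  using SL2Z_Ints[OF assms] by (auto simp: bottom_row_def elim!: Ints_cases)

lemma bottom_row_nonzero:
  assumes "A \<in> SL2Z"
  shows "bottom_row A \<noteq> (0, 0)"
  using SL2Z_det[OF assms] bottom_row_entries[OF assms] by auto

text \<open>Two matrices of determinant 1 with the same bottom row differ by an upper triangular factor on the
  left. Hence the bottom row determines the coset; the extra factor \<open>\<gamma>\<close> on the right makes this
  usable for the behaviour at every cusp.\<close>

lemma bottom_row_eq_imp_cusp_coset:
  assumes \<rho>: "\<rho> \<in> SL2Z" and \<gamma>: "\<gamma> \<in> SL2Z" and g: "g \<in> Gamma0 N" "g' \<in> Gamma0 N"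
    and eq: "bottom_row (matrix_inv \<rho> ** g ** \<gamma>) = bottom_row (matrix_inv \<rho> ** g' ** \<gamma>)"
  shows "\<exists>h\<in>Gamma_cusp N \<rho>. g' = h ** g"
proof -
  define A B where "A = matrix_inv \<rho> ** g ** \<gamma>" and "B = matrix_inv \<rho> ** g' ** \<gamma>"
  have AB: "A \<in> SL2Z" "B \<in> SL2Z"
    using \<rho> \<gamma> g by (simp_all add: A_def B_def SL2Z_mult SL2Z_matrix_inv Gamma0_SL2Z)
  have g': "g \<in> SL2Z" using g Gamma0_SL2Z by blast
  have "matrix_inv \<rho> ** (g' ** matrix_inv g) ** \<rho> = B ** matrix_inv A"
  proof -
    have "(matrix_inv \<rho> ** (g' ** matrix_inv g) ** \<rho>) ** A = B"
      using \<rho> g' by (simp add: A_def B_def SL2Z_cancel flip: matrix_mul_assoc)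
    then show ?thesis by (rule SL2Z_solve_right[OF AB(1)])
  qed
  moreover have "(B ** matrix_inv A) $ 2 $ 1 = 0"
    using eq bottom_row_entries[OF AB(1)] bottom_row_entries[OF AB(2)]
    by (simp add: matrix_mult_2 SL2Z_matrix_inv[OF AB(1)] flip: A_def B_def)
  ultimately have "g' ** matrix_inv g \<in> Gamma_cusp N \<rho>"
    using \<rho> g by (simp add: Gamma_cusp_iff Gamma0_mult Gamma0_matrix_inv)
  moreover have "g' = (g' ** matrix_inv g) ** g"
    using g' by (simp add: SL2Z_matrix_inv flip: matrix_mul_assoc)
  ultimately show ?thesis by blast
qed

text \<open>The values of \<open>c\<close> on the representatives, transported along the injection that sends a coset to its bottom
  row, and extended by zero to all integer pairs. These coefficients are independent of \<open>\<tau>\<close>.\<close>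

definition coset_coeff :: "nat \<Rightarrow> rat^2^2 \<Rightarrow> rat^2^2 \<Rightarrow> (rat^2^2 \<Rightarrow> complex) \<Rightarrow> int \<times> int \<Rightarrow> complex" where
  "coset_coeff N \<rho> \<gamma> c x =
     (let R = right_cosets (Gamma_cusp N \<rho>) (Gamma0 N);
          row = (\<lambda>C. bottom_row (matrix_inv \<rho> ** coset_rep C ** \<gamma>))
      in if x \<in> row ` R then c (coset_rep (inv_into R row x)) else 0)"

lemma norm_coset_coeff_le:
  assumes \<rho>: "\<rho> \<in> SL2Z" and c: "\<And>g. g \<in> Gamma0 N \<Longrightarrow> norm (c g) \<le> 1"
  shows "norm (coset_coeff N \<rho> \<gamma> c x) \<le> 1"
  unfolding coset_coeff_def Let_def by (auto intro!: c coset_rep(1)[OF \<rho>] inv_into_into)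

lemma coset_sum_eq_lattice_sum:
  assumes \<rho>: "\<rho> \<in> SL2Z" and \<gamma>: "\<gamma> \<in> SL2Z"
  shows "(\<Sum>\<^sub>\<infinity>C\<in>right_cosets (Gamma_cusp N \<rho>) (Gamma0 N).
        c (coset_rep C) * t (bottom_row (matrix_inv \<rho> ** coset_rep C ** \<gamma>)))
      = (\<Sum>\<^sub>\<infinity>x. coset_coeff N \<rho> \<gamma> c x * t x)"
proof -
  let ?R = "right_cosets (Gamma_cusp N \<rho>) (Gamma0 N)" and ?a = "coset_coeff N \<rho> \<gamma> c"
  define row where "row C = bottom_row (matrix_inv \<rho> ** coset_rep C ** \<gamma>)" for C
  have a: "?a x = (if x \<in> row ` ?R then c (coset_rep (inv_into ?R row x)) else 0)" for x
    by (simp add: coset_coeff_def Let_def row_def[abs_def])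
  have inj: "inj_on row ?R"
  proof (rule inj_onI)
    fix C D assume CD: "C \<in> ?R" "D \<in> ?R" "row C = row D"
    then obtain h where "h \<in> Gamma_cusp N \<rho>" "coset_rep D = h ** coset_rep C"
      using bottom_row_eq_imp_cusp_coset[OF \<rho> \<gamma>] coset_rep(1)[OF \<rho>] unfolding row_def by metis
    then show "C = D" using coset_eqI[OF \<rho>] CD by blast
  qed
  have "(\<Sum>\<^sub>\<infinity>C\<in>?R. c (coset_rep C) * t (row C)) = (\<Sum>\<^sub>\<infinity>C\<in>?R. ((\<lambda>x. ?a x * t x) \<circ> row) C)"
    by (rule infsum_cong) (simp add: a inv_into_f_f[OF inj])
  also have "\<dots> = (\<Sum>\<^sub>\<infinity>x\<in>row ` ?R. ?a x * t x)" by (rule infsum_reindex[OF inj, symmetric])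
  also have "\<dots> = (\<Sum>\<^sub>\<infinity>x. ?a x * t x)" by (rule infsum_cong_neutral) (auto simp: a)
  finally show ?thesis by (simp add: row_def)
qed

section \<open>The slash action\<close>

lemma aut_factor_bottom_row:
  assumes "A \<in> SL2Z"
  shows "aut_factor A \<tau> = lattice_form (bottom_row A) \<tau>"
  by (simp add: aut_factor_def lattice_form_def bottom_row_entries[OF assms])

lemma aut_factor_nonzero:
  assumes "A \<in> SL2Z" "\<tau> \<in> upper_half_plane"
  shows "aut_factor A \<tau> \<noteq> 0"
  using assms bottom_row_nonzero[OF assms(1)]
  by (simp add: aut_factor_bottom_row lattice_form_eq_0_iff upper_half_plane_def)

lemma Im_moebius:
  assumes A: "A \<in> SL2Z" and \<tau>: "\<tau> \<in> upper_half_plane"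
  shows "Im (moebius A \<tau>) = Im \<tau> / (norm (aut_factor A \<tau>))\<^sup>2"
proof -
  define a b c d :: real where "a = of_rat (A $ 1 $ 1)" and "b = of_rat (A $ 1 $ 2)"
    and "c = of_rat (A $ 2 $ 1)" and "d = of_rat (A $ 2 $ 2)"
  have conv: "(of_rat q :: complex) = of_real (of_rat q)" for q
    by (cases q) (simp add: of_rat_rat)
  have "a * d - b * c = of_rat (A $ 1 $ 1 * A $ 2 $ 2 - A $ 1 $ 2 * A $ 2 $ 1)"
    by (simp add: a_def b_def c_def d_def of_rat_mult of_rat_diff)
  then have det: "a * d - b * c = 1" using SL2Z_det[OF A] by simp
  have j: "aut_factor A \<tau> = of_real c * \<tau> + of_real d"
    by (simp add: aut_factor_def c_def d_def conv)
  have m: "moebius A \<tau> = (of_real a * \<tau> + of_real b) / (of_real c * \<tau> + of_real d)"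
    by (simp add: moebius_def a_def b_def c_def d_def conv)
  have "Im (moebius A \<tau>) = (a * d - b * c) * Im \<tau> / (norm (aut_factor A \<tau>))\<^sup>2"
    unfolding m j by (simp add: Im_divide cmod_power2) (simp add: algebra_simps)
  then show ?thesis by (simp add: det)
qed

lemma moebius_in_upper_half_plane:
  assumes "A \<in> SL2Z" "\<tau> \<in> upper_half_plane"
  shows "moebius A \<tau> \<in> upper_half_plane"
  using Im_moebius[OF assms] aut_factor_nonzero[OF assms] assms(2) by (simp add: upper_half_plane_def)

lemma aut_factor_mult:
  assumes B: "B \<in> SL2Z" and \<tau>: "\<tau> \<in> upper_half_plane"
  shows "aut_factor (A ** B) \<tau> = aut_factor A (moebius B \<tau>) * aut_factor B \<tau>"
  using aut_factor_nonzero[OF B \<tau>] unfolding aut_factor_def moebius_def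
  by (simp add: distrib_right matrix_mult_2 of_rat_add of_rat_mult) (simp add: algebra_simps)

lemma moebius_mult:
  assumes B: "B \<in> SL2Z" and \<tau>: "\<tau> \<in> upper_half_plane"
  shows "moebius (A ** B) \<tau> = moebius A (moebius B \<tau>)"
proof -
  let ?j = "aut_factor B \<tau>" and ?z = "moebius B \<tau>"
  have j: "?j \<noteq> 0" by (rule aut_factor_nonzero[OF B \<tau>])
  have "of_rat ((A ** B) $ 1 $ 1) * \<tau> + of_rat ((A ** B) $ 1 $ 2) = (of_rat (A $ 1 $ 1) * ?z + of_rat (A $ 1 $ 2)) * ?j"
    using j unfolding aut_factor_def moebius_def
    by (simp add: distrib_right matrix_mult_2 of_rat_add of_rat_mult) (simp add: algebra_simps)
  moreover have "of_rat ((A ** B) $ 2 $ 1) * \<tau> + of_rat ((A ** B) $ 2 $ 2) = (of_rat (A $ 2 $ 1) * ?z + of_rat (A $ 2 $ 2)) * ?j"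
    using aut_factor_mult[OF B \<tau>, of A] by (simp add: aut_factor_def)
  ultimately have "moebius (A ** B) \<tau> = ((of_rat (A $ 1 $ 1) * ?z + of_rat (A $ 1 $ 2)) * ?j) / ((of_rat (A $ 2 $ 1) * ?z + of_rat (A $ 2 $ 2)) * ?j)"
    by (simp add: moebius_def[of "A ** B"])
  also have "\<dots> = moebius A ?z" using j by (simp add: moebius_def[of A])
  finally show ?thesis .
qed

lemma slash_SL2Z:
  assumes "A \<in> SL2Z"
  shows "slash k f A \<tau> = aut_factor A \<tau> powi (- k) * f (moebius A \<tau>)"
  using assms by (simp add: slash_def SL2Z_def)

text \<open>The cocycle relation for the automorphy factor; as both determinants are 1, no power of a
  determinant enters.\<close>

lemma slash_mult:
  assumes A: "A \<in> SL2Z" and B: "B \<in> SL2Z" and \<tau>: "\<tau> \<in> upper_half_plane"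
  shows "slash k f (A ** B) \<tau> = slash k (slash k f A) B \<tau>"
  by (simp add: slash_SL2Z A B SL2Z_mult aut_factor_mult[OF B \<tau>] moebius_mult[OF B \<tau>]
      power_int_mult_distrib)

definition maass_seed :: "int \<Rightarrow> complex \<Rightarrow> complex" where
  "maass_seed k z = of_real (Im z powi (1 - k)) / of_int (1 - k)"

text \<open>With \<open>J J' = |J|\<^sup>2\<close>, the factor \<open>J\<^sup>m\<close> cancels all but one of the powers of \<open>1 / J\<close> in
  \<open>(v / |J|\<^sup>2)\<^bsup>m+1\<^esup>\<close>.\<close>

lemma slash_maass_seed:
  assumes A: "A \<in> SL2Z" and \<tau>: "\<tau> \<in> upper_half_plane" and k: "k = - int m"
  shows "slash k (maass_seed k) A \<tau> = lattice_term (Suc m) 0 1 (Suc m) (bottom_row A) \<tau> / of_nat (Suc m)"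
proof -
  define j j' where "j = lattice_form (bottom_row A) \<tau>" and "j' = lattice_form (bottom_row A) (cnj \<tau>)"
  have aut: "aut_factor A \<tau> = j" unfolding j_def by (rule aut_factor_bottom_row[OF A])
  have j: "j \<noteq> 0" using aut_factor_nonzero[OF A \<tau>] aut by simp
  have "of_real ((norm j)\<^sup>2) = j * j'"
    unfolding j'_def j_def cnj_lattice_form[symmetric] by (rule complex_norm_square)
  then have v: "(of_real (Im (moebius A \<tau>)) :: complex) = of_real (Im \<tau>) * inverse j * inverse j'"
    unfolding Im_moebius[OF A \<tau>] aut by (simp add: divide_inverse)
  have e: "1 - k = int (Suc m)" "- k = int m" using k by simp_all
  have "slash k (maass_seed k) A \<tau> = j ^ m * (of_real (Im \<tau>) * inverse j * inverse j') ^ Suc m / of_nat (Suc m)"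
    unfolding slash_SL2Z[OF A] maass_seed_def aut e power_int_of_nat of_real_power v by simp
  also have "j ^ m * (of_real (Im \<tau>) * inverse j * inverse j') ^ Suc m
      = (j ^ m * inverse j ^ m) * (of_real (Im \<tau>) ^ Suc m * inverse j * inverse j' ^ Suc m)"
    by (simp add: power_mult_distrib mult_ac)
  also have "j ^ m * inverse j ^ m = 1" using j by (simp flip: power_mult_distrib)
  finally show ?thesis by (simp add: lattice_term_def j_def j'_def)
qed

text \<open>Such a matrix is a translation up to sign, and an even weight does not see the sign.\<close>

lemma slash_maass_seed_upper_triangular:
  assumes A: "A \<in> SL2Z" "A $ 2 $ 1 = 0" and \<tau>: "\<tau> \<in> upper_half_plane" and k: "even k"
  shows "slash k (maass_seed k) A \<tau> = maass_seed k \<tau>"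
proof -
  obtain a d where ad: "A $ 1 $ 1 = of_int a" "A $ 2 $ 2 = of_int d"
    using SL2Z_Ints[OF A(1)] by (metis Ints_cases)
  have "of_int (a * d) = (1 :: rat)" using SL2Z_det[OF A(1)] A(2) ad by simp
  then have "a * d = 1" by linarith
  then have "d = 1 \<or> d = -1" using zmult_eq_1_iff by blast
  then have aut: "aut_factor A \<tau> = 1 \<or> aut_factor A \<tau> = -1"
    by (auto simp: aut_factor_def A(2) ad)
  then have "Im (moebius A \<tau>) = Im \<tau>" using Im_moebius[OF A(1) \<tau>] by auto
  moreover have "aut_factor A \<tau> powi (- k) = 1" using aut k by (auto simp: power_int_minus_left)
  ultimately show ?thesis by (simp add: slash_SL2Z[OF A(1)] maass_seed_def)
qed

section \<open>Values of a Dirichlet character\<close>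

lemma dirichlet_character_mult: "dirichlet_character N chi \<Longrightarrow> chi (m * n) = chi m * chi n"
  by (simp add: dirichlet_character_def)

lemma dirichlet_character_periodic:
  assumes "dirichlet_character N chi"
  shows "chi (n + int N * m) = chi n"
proof (induction m rule: int_induct[where k = 0])
  case (step1 i)
  have "chi (n + int N * i + int N) = chi (n + int N * i)" using assms by (simp add: dirichlet_character_def)
  then show ?case using step1 by (simp add: algebra_simps)
next
  case (step2 i)
  have "chi (n + int N * (i - 1) + int N) = chi (n + int N * (i - 1))" using assms by (simp add: dirichlet_character_def)
  then show ?case using step2 by (simp add: algebra_simps)
qed simp

lemma dirichlet_character_1:
  assumes "dirichlet_character N chi"
  shows "chi 1 = 1"
proof -
  have "chi 1 \<noteq> 0" using assms by (simp add: dirichlet_character_def)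
  moreover have "chi 1 = chi 1 * chi 1" using dirichlet_character_mult[OF assms, of 1 1] by simp
  ultimately show ?thesis by simp
qed

text \<open>A periodic function takes finitely many values, so the powers of \<open>chi n\<close>, being values of \<open>chi\<close>
  themselves, stay bounded.\<close>

lemma norm_dirichlet_character_le:
  assumes chi: "dirichlet_character N chi" and N: "N \<ge> 1"
  shows "norm (chi n) \<le> 1"
proof (rule ccontr)
  assume "\<not> norm (chi n) \<le> 1"
  then have n: "norm (chi n) > 1" by simp
  define B where "B = Max ((\<lambda>r. norm (chi r)) ` {0..<int N})"
  have bound: "norm (chi r) \<le> B" for r
  proof -
    have "chi r = chi (r mod int N)"
      using dirichlet_character_periodic[OF chi, of "r mod int N" "r div int N"] by simp
    moreover have "r mod int N \<in> {0..<int N}" using N by simp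
    ultimately show ?thesis unfolding B_def by (auto intro!: Max_ge)
  qed
  have pow: "chi (n ^ i) = chi n ^ i" for i
    by (induction i) (simp_all add: dirichlet_character_1[OF chi] dirichlet_character_mult[OF chi])
  obtain i where "B < norm (chi n) ^ i" using real_arch_pow[OF n] by blast
  moreover have "norm (chi n) ^ i \<le> B" using bound[of "n ^ i"] by (simp add: pow norm_power)
  ultimately show False by simp
qed

lemma char_mat_mult:
  assumes chi: "dirichlet_character N chi" and "A \<in> Gamma0 N" "B \<in> Gamma0 N"
  shows "char_mat chi (A ** B) = char_mat chi A * char_mat chi B"
proof -
  obtain m where m: "A $ 2 $ 1 = of_int (int N * m)" using assms Gamma0_lower_left by blast
  obtain b d d' where bd: "B $ 1 $ 2 = of_int b" "A $ 2 $ 2 = of_int d" "B $ 2 $ 2 = of_int d'"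
    using SL2Z_Ints[OF Gamma0_SL2Z] assms by (metis Ints_cases)
  have "(A ** B) $ 2 $ 2 = of_int (d * d' + int N * (m * b))"
    by (simp add: matrix_mult_2 m bd)
  then have "char_mat chi (A ** B) = chi (d * d' + int N * (m * b))"
    unfolding char_mat_def by (simp only: floor_of_int)
  also have "\<dots> = chi d * chi d'"
    by (simp only: dirichlet_character_periodic[OF chi] dirichlet_character_mult[OF chi])
  finally show ?thesis by (simp add: char_mat_def bd)
qed

text \<open>On \<open>\<Gamma>\<^sub>0(N)\<close> the value at the inverse matrix is an inverse, and both have modulus at most 1.\<close>

lemma norm_char_mat:
  assumes chi: "dirichlet_character N chi" and N: "N \<ge> 1" and A: "A \<in> Gamma0 N"
  shows "norm (char_mat chi A) = 1"
proof -
  have "char_mat chi (matrix_inv A) * char_mat chi A = char_mat chi (mat 1)"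
    using char_mat_mult[OF chi Gamma0_matrix_inv[OF A] A] SL2Z_matrix_inv(1)[OF Gamma0_SL2Z[OF A]] by simp
  also have "\<dots> = 1" using dirichlet_character_1[OF chi] by (simp add: char_mat_def mat_def)
  finally have "norm (char_mat chi (matrix_inv A)) * norm (char_mat chi A) = 1" by (metis norm_mult norm_one)
  moreover have "norm (char_mat chi B) \<le> 1" for B
    unfolding char_mat_def by (rule norm_dirichlet_character_le[OF chi N])
  ultimately show ?thesis
    by (metis mult_left_le_one_le mult.commute norm_ge_zero order_antisym)
qed

section \<open>The Maass-Eisenstein series\<close>

context
  fixes N :: nat and chi :: "int \<Rightarrow> complex" and \<rho> :: "rat^2^2" and k :: int and m :: nat
  assumes N: "N \<ge> 1" and chi: "dirichlet_character N chi" and \<rho>: "\<rho> \<in> SL2Z"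
    and trivial: "\<And>g. g \<in> Gamma_cusp N \<rho> \<Longrightarrow> char_mat chi g = 1"
    and k: "k = - int m" "even k" "k < 0"
begin

abbreviation "cosets \<equiv> right_cosets (Gamma_cusp N \<rho>) (Gamma0 N)"

definition summand :: "rat^2^2 \<Rightarrow> complex \<Rightarrow> complex" where
  "summand g \<tau> = cnj (char_mat chi g) * slash k (maass_seed k) (matrix_inv \<rho> ** g) \<tau>"

lemma F_series_eq: "F_series k N chi \<rho> \<tau> = (\<Sum>\<^sub>\<infinity>C\<in>cosets. summand (coset_rep C) \<tau>)"
  by (simp add: F_series_def coset_sum_def summand_def coset_rep_def maass_seed_def[abs_def])

text \<open>Moving \<open>h\<close> past \<open>\<rho>\<close> turns it into an upper triangular matrix that fixes the seed, while the character is
  trivial on \<open>h\<close>. So the sum over cosets does not depend on the representatives.\<close>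

lemma summand_left_invariant:
  assumes h: "h \<in> Gamma_cusp N \<rho>" and g: "g \<in> Gamma0 N" and \<tau>: "\<tau> \<in> upper_half_plane"
  shows "summand (h ** g) \<tau> = summand g \<tau>"
proof -
  let ?M = "matrix_inv \<rho> ** h ** \<rho>" and ?A = "matrix_inv \<rho> ** g"
  have h': "h \<in> Gamma0 N" using h by (rule Gamma_cusp_Gamma0)
  have M: "?M \<in> SL2Z" "?M $ 2 $ 1 = 0"
    using h h' \<rho> by (simp_all add: Gamma_cusp_iff SL2Z_mult SL2Z_matrix_inv Gamma0_SL2Z)
  have A: "?A \<in> SL2Z" using g \<rho> by (simp add: SL2Z_mult SL2Z_matrix_inv Gamma0_SL2Z)
  have "matrix_inv \<rho> ** (h ** g) = ?M ** ?A"
    using \<rho> by (simp add: SL2Z_cancel flip: matrix_mul_assoc)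
  then have "slash k (maass_seed k) (matrix_inv \<rho> ** (h ** g)) \<tau>
      = slash k (slash k (maass_seed k) ?M) ?A \<tau>"
    by (simp add: slash_mult[OF M(1) A \<tau>])
  also have "\<dots> = slash k (maass_seed k) ?A \<tau>"
    using slash_maass_seed_upper_triangular[OF M moebius_in_upper_half_plane[OF A \<tau>] k(2)]
    by (simp add: slash_SL2Z[OF A])
  finally show ?thesis
    by (simp add: summand_def char_mat_mult[OF chi h' g] trivial[OF h])
qed

text \<open>The slash action passes through the sum and, by the cocycle relation, acts on the matrices by right
  multiplication. The coefficients are not affected.\<close>

lemma slash_F_series:
  assumes \<gamma>: "\<gamma> \<in> SL2Z" and \<tau>: "\<tau> \<in> upper_half_plane"
  shows "slash k (F_series k N chi \<rho>) \<gamma> \<tau> = (\<Sum>\<^sub>\<infinity>C\<in>cosets.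
    cnj (char_mat chi (coset_rep C)) * slash k (maass_seed k) (matrix_inv \<rho> ** coset_rep C ** \<gamma>) \<tau>)"
proof -
  have "slash k (F_series k N chi \<rho>) \<gamma> \<tau>
      = (\<Sum>\<^sub>\<infinity>C\<in>cosets. aut_factor \<gamma> \<tau> powi (- k) * summand (coset_rep C) (moebius \<gamma> \<tau>))"
    by (simp add: slash_SL2Z[OF \<gamma>] F_series_eq infsum_cmult_right')
  also have "\<dots> = (\<Sum>\<^sub>\<infinity>C\<in>cosets. cnj (char_mat chi (coset_rep C))
      * slash k (maass_seed k) (matrix_inv \<rho> ** coset_rep C ** \<gamma>) \<tau>)"
  proof (rule infsum_cong)
    fix C assume C: "C \<in> cosets"
    have "matrix_inv \<rho> ** coset_rep C \<in> SL2Z"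
      using \<rho> coset_rep(1)[OF \<rho> C] by (simp add: SL2Z_mult SL2Z_matrix_inv Gamma0_SL2Z)
    then show "aut_factor \<gamma> \<tau> powi (- k) * summand (coset_rep C) (moebius \<gamma> \<tau>)
        = cnj (char_mat chi (coset_rep C)) * slash k (maass_seed k) (matrix_inv \<rho> ** coset_rep C ** \<gamma>) \<tau>"
      by (simp add: slash_mult[OF _ \<gamma> \<tau>] slash_SL2Z[OF \<gamma>] summand_def mult_ac)
  qed
  finally show ?thesis .
qed

lemma bij_betw_cosets:
  assumes \<gamma>: "\<gamma> \<in> Gamma0 N"
  shows "bij_betw (\<lambda>C. (\<lambda>g. g ** \<gamma>) ` C) cosets cosets"
proof (rule bij_betwI[of _ _ _ "\<lambda>C. (\<lambda>g. g ** matrix_inv \<gamma>) ` C"])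
  have into: "(\<lambda>C. (\<lambda>g. g ** \<delta>) ` C) \<in> cosets \<rightarrow> cosets" if \<delta>: "\<delta> \<in> Gamma0 N" for \<delta>
  proof
    fix C assume "C \<in> cosets"
    then obtain g where g: "g \<in> Gamma0 N" "C = (\<lambda>h. h ** g) ` Gamma_cusp N \<rho>"
      by (auto simp: right_cosets_def)
    have "(\<lambda>g. g ** \<delta>) ` C = (\<lambda>h. h ** (g ** \<delta>)) ` Gamma_cusp N \<rho>"
      by (simp add: g(2) image_image matrix_mul_assoc)
    then show "(\<lambda>g. g ** \<delta>) ` C \<in> cosets"
      unfolding right_cosets_def using Gamma0_mult[OF g(1) \<delta>] by blast
  qed
  show "(\<lambda>C. (\<lambda>g. g ** \<gamma>) ` C) \<in> cosets \<rightarrow> cosets" by (rule into[OF \<gamma>])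
  show "(\<lambda>C. (\<lambda>g. g ** matrix_inv \<gamma>) ` C) \<in> cosets \<rightarrow> cosets"
    by (rule into[OF Gamma0_matrix_inv[OF \<gamma>]])
  note \<gamma>' = SL2Z_matrix_inv[OF Gamma0_SL2Z[OF \<gamma>]]
  show "(\<lambda>g. g ** matrix_inv \<gamma>) ` (\<lambda>g. g ** \<gamma>) ` C = C" for C
    by (simp add: image_image \<gamma>' flip: matrix_mul_assoc)
  show "(\<lambda>g. g ** \<gamma>) ` (\<lambda>g. g ** matrix_inv \<gamma>) ` C = C" for C
    by (simp add: image_image \<gamma>' flip: matrix_mul_assoc)
qed

text \<open>Reindexing by \<open>C \<mapsto> C \<gamma>\<close> replaces the character value at \<open>g\<close> by the one at \<open>g \<gamma>\<close>; as values have modulus 1,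
  the factor \<open>chi \<gamma>\<close> can be taken out.\<close>

lemma F_series_modular:
  assumes \<gamma>: "\<gamma> \<in> Gamma0 N" and \<tau>: "\<tau> \<in> upper_half_plane"
  shows "slash k (F_series k N chi \<rho>) \<gamma> \<tau> = char_mat chi \<gamma> * F_series k N chi \<rho> \<tau>"
proof -
  have unit: "char_mat chi \<gamma> * cnj (char_mat chi \<gamma>) = 1"
    using norm_char_mat[OF chi N \<gamma>] by (simp flip: complex_norm_square)
  have "slash k (F_series k N chi \<rho>) \<gamma> \<tau>
      = (\<Sum>\<^sub>\<infinity>C\<in>cosets. char_mat chi \<gamma> * summand (coset_rep ((\<lambda>g. g ** \<gamma>) ` C)) \<tau>)"
    unfolding slash_F_series[OF Gamma0_SL2Z[OF \<gamma>] \<tau>]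
  proof (rule infsum_cong)
    fix C assume C: "C \<in> cosets"
    let ?g = "coset_rep C" and ?D = "(\<lambda>g. g ** \<gamma>) ` C"
    have g: "?g \<in> Gamma0 N" by (rule coset_rep(1)[OF \<rho> C])
    have D: "?D \<in> cosets" using bij_betw_cosets[OF \<gamma>] C by (auto simp: bij_betw_def)
    have "?g ** \<gamma> \<in> ?D"
    proof (rule imageI)
      have "mat 1 ** ?g \<in> (\<lambda>h. h ** ?g) ` Gamma_cusp N \<rho>" by (rule imageI[OF mat_in_Gamma_cusp(1)[OF \<rho>]])
      then show "?g \<in> C" using coset_rep(2)[OF \<rho> C] by simp
    qed
    then obtain h where h: "h \<in> Gamma_cusp N \<rho>" "?g ** \<gamma> = h ** coset_rep ?D"
      using coset_rep(2)[OF \<rho> D] by auto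
    have "summand (coset_rep ?D) \<tau> = summand (?g ** \<gamma>) \<tau>"
      unfolding h(2) by (rule summand_left_invariant[OF h(1) coset_rep(1)[OF \<rho> D] \<tau>, symmetric])
    then have "char_mat chi \<gamma> * summand (coset_rep ?D) \<tau> = (char_mat chi \<gamma> * cnj (char_mat chi \<gamma>))
        * (cnj (char_mat chi ?g) * slash k (maass_seed k) (matrix_inv \<rho> ** ?g ** \<gamma>) \<tau>)"
      by (simp add: summand_def char_mat_mult[OF chi g \<gamma>] matrix_mul_assoc mult_ac)
    then show "cnj (char_mat chi ?g) * slash k (maass_seed k) (matrix_inv \<rho> ** ?g ** \<gamma>) \<tau>
        = char_mat chi \<gamma> * summand (coset_rep ?D) \<tau>"
      by (simp add: unit)
  qed
  also have "\<dots> = char_mat chi \<gamma> * F_series k N chi \<rho> \<tau>"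
    unfolding F_series_eq infsum_cmult_right'
    by (simp only: infsum_reindex_bij_betw[OF bij_betw_cosets[OF \<gamma>], of "\<lambda>C. summand (coset_rep C) \<tau>"])
  finally show ?thesis .
qed

text \<open>Here parity enters: it excludes \<open>k = -1\<close>, for which \<open>w = 2 - k\<close> would be 3, below the bound 4 used
  for the summability.\<close>

lemma weight_ge: "m \<ge> 2" "Suc (Suc m) \<ge> 4"
proof -
  have "even m" "m > 0" using k by auto
  then show "m \<ge> 2" by (metis Suc_leI even_Suc nat_less_le numeral_2_eq_2 odd_one One_nat_def)
  then show "Suc (Suc m) \<ge> 4" by simp
qed

abbreviation F_coeff :: "rat^2^2 \<Rightarrow> int \<times> int \<Rightarrow> complex" where
  "F_coeff \<gamma> \<equiv> coset_coeff N \<rho> \<gamma> (\<lambda>g. cnj (char_mat chi g))"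

lemma norm_F_coeff_le: "norm (F_coeff \<gamma> x) \<le> 1"
  by (rule norm_coset_coeff_le[OF \<rho>]) (simp add: char_mat_def norm_dirichlet_character_le[OF chi N])

lemma slash_F_series_eq_lattice_sum:
  assumes \<gamma>: "\<gamma> \<in> SL2Z" and \<tau>: "\<tau> \<in> upper_half_plane"
  shows "slash k (F_series k N chi \<rho>) \<gamma> \<tau>
    = 1 / of_nat (Suc m) * lattice_sum (F_coeff \<gamma>) (Suc m) 0 1 (Suc m) \<tau>"
proof -
  let ?t = "\<lambda>x. lattice_term (Suc m) 0 1 (Suc m) x \<tau> / of_nat (Suc m)"
  have "slash k (F_series k N chi \<rho>) \<gamma> \<tau>
      = (\<Sum>\<^sub>\<infinity>C\<in>cosets. cnj (char_mat chi (coset_rep C)) * ?t (bottom_row (matrix_inv \<rho> ** coset_rep C ** \<gamma>)))"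
    unfolding slash_F_series[OF \<gamma> \<tau>]
  proof (rule infsum_cong)
    fix C assume C: "C \<in> cosets"
    have "matrix_inv \<rho> ** coset_rep C ** \<gamma> \<in> SL2Z"
      using \<rho> \<gamma> coset_rep(1)[OF \<rho> C] by (simp add: SL2Z_mult SL2Z_matrix_inv Gamma0_SL2Z)
    then show "cnj (char_mat chi (coset_rep C)) * slash k (maass_seed k) (matrix_inv \<rho> ** coset_rep C ** \<gamma>) \<tau>
        = cnj (char_mat chi (coset_rep C)) * ?t (bottom_row (matrix_inv \<rho> ** coset_rep C ** \<gamma>))"
      by (simp only: slash_maass_seed[OF _ \<tau> k(1)])
  qed
  also have "\<dots> = (\<Sum>\<^sub>\<infinity>x. F_coeff \<gamma> x * ?t x)"
    by (rule coset_sum_eq_lattice_sum[OF \<rho> \<gamma>])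
  also have "\<dots> = (\<Sum>\<^sub>\<infinity>x. 1 / of_nat (Suc m) * (F_coeff \<gamma> x * lattice_term (Suc m) 0 1 (Suc m) x \<tau>))"
    by (rule infsum_cong) simp
  finally show ?thesis by (simp only: infsum_cmult_right' lattice_sum_def)
qed

lemma poly_growth_F_series:
  assumes \<gamma>: "\<gamma> \<in> SL2Z"
  shows "slash k (F_series k N chi \<rho>) \<gamma> \<in> O[filtercomap Im at_top](\<lambda>\<tau>. of_real (Im \<tau> powr real (Suc m)))"
proof -
  obtain M where M: "\<And>\<tau>. Im \<tau> \<ge> 1 \<Longrightarrow> norm (lattice_sum (F_coeff \<gamma>) (Suc m) 0 1 (Suc m) \<tau>) \<le> M * Im \<tau> ^ Suc m"
    using lattice_sum_growth[where a = "F_coeff \<gamma>" and p = "Suc m", OF norm_F_coeff_le weight_ge(2), of 1 "Suc m"]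
    by (auto simp del: power_Suc)
  show ?thesis
  proof (rule bigoI)
    have "\<forall>\<^sub>F \<tau> in filtercomap Im at_top. Im \<tau> \<ge> 1"
      by (rule eventually_filtercomapI[OF eventually_ge_at_top])
    then show "\<forall>\<^sub>F \<tau> in filtercomap Im at_top. norm (slash k (F_series k N chi \<rho>) \<gamma> \<tau>)
        \<le> (1 / real (Suc m) * M) * norm (complex_of_real (Im \<tau> powr real (Suc m)))"
    proof eventually_elim
      case (elim \<tau>)
      then have "norm (slash k (F_series k N chi \<rho>) \<gamma> \<tau>)
          = 1 / real (Suc m) * norm (lattice_sum (F_coeff \<gamma>) (Suc m) 0 1 (Suc m) \<tau>)"
        by (subst slash_F_series_eq_lattice_sum[OF \<gamma>]) (simp_all add: upper_half_plane_def norm_mult norm_divide del: of_nat_Suc)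
      also have "\<dots> \<le> 1 / real (Suc m) * (M * Im \<tau> ^ Suc m)"
        using M[OF elim] by (intro mult_left_mono) auto
      finally show ?case using elim by (simp add: powr_realpow norm_power del: of_nat_Suc power_Suc)
    qed
  qed
qed

lemma exp_growth_F_series:
  assumes \<gamma>: "\<gamma> \<in> SL2Z"
  shows "slash k (F_series k N chi \<rho>) \<gamma> \<in> O[filtercomap Im at_top](\<lambda>\<tau>. of_real (exp (1 * Im \<tau>)))"
proof (rule landau_o.big_trans[OF poly_growth_F_series[OF \<gamma>]])
  have "\<forall>\<^sub>F x in at_top. x ^ Suc m / exp x < (1 :: real)"
    by (rule order_tendstoD(2)[OF tendsto_power_div_exp_0]) simp
  then have "\<forall>\<^sub>F x in at_top. x > 0 \<and> x ^ Suc m \<le> exp (x :: real)"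
    using eventually_gt_at_top[of "0 :: real"]
    by eventually_elim (simp add: divide_less_eq)
  then have "\<forall>\<^sub>F \<tau> in filtercomap Im at_top. Im \<tau> > 0 \<and> Im \<tau> ^ Suc m \<le> exp (Im \<tau>)"
    by (rule eventually_filtercomapI)
  then show "(\<lambda>\<tau>. complex_of_real (Im \<tau> powr real (Suc m)))
      \<in> O[filtercomap Im at_top](\<lambda>\<tau>. complex_of_real (exp (1 * Im \<tau>)))"
    by (intro bigoI[of _ 1]) (auto elim!: eventually_mono simp: powr_realpow simp del: of_nat_Suc power_Suc)
qed

lemma F_series_eq_lattice_sum:
  assumes "\<tau> \<in> upper_half_plane"
  shows "F_series k N chi \<rho> \<tau> = 1 / of_nat (Suc m) * lattice_sum (F_coeff (mat 1)) (Suc m) 0 1 (Suc m) \<tau>"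
proof -
  have one: "mat 1 \<in> SL2Z" using mat_in_Gamma0(1) by (rule Gamma0_SL2Z)
  have "slash k (F_series k N chi \<rho>) (mat 1) \<tau> = F_series k N chi \<rho> \<tau>"
    unfolding slash_SL2Z[OF one] by (simp add: aut_factor_def moebius_def mat_def)
  then show ?thesis using slash_F_series_eq_lattice_sum[OF one assms] by simp
qed

text \<open>The coefficients are those of \<open>F\<close>, which makes it possible to compare the two series after
  differentiation. The conjugation turns \<open>J'\<close> into \<open>J\<close> and the conjugate character into the
  character itself.\<close>

lemma eisenstein_eq_lattice_sum:
  "eisenstein (2 - k) N (\<lambda>n. cnj (chi n)) \<rho> \<tau> = cnj (lattice_sum (F_coeff (mat 1)) 0 0 0 (Suc (Suc m)) \<tau>)"
proof -
  have one: "mat 1 \<in> SL2Z" using mat_in_Gamma0(1) by (rule Gamma0_SL2Z)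
    let ?t = "\<lambda>x. lattice_term 0 0 0 (Suc (Suc m)) x \<tau>"
    have e: "- (2 - k) = - int (Suc (Suc m))" using k(1) by simp
    have t: "cnj (?t (bottom_row A)) = aut_factor A \<tau> powi (- (2 - k))" if A: "A \<in> SL2Z" for A
      unfolding e power_int_minus power_int_of_nat
      by (simp only: lattice_term_def aut_factor_bottom_row[OF A] complex_cnj_mult complex_cnj_power
          complex_cnj_inverse cnj_lattice_form complex_cnj_cnj power_inverse) simp
    have "eisenstein (2 - k) N (\<lambda>n. cnj (chi n)) \<rho> \<tau> = (\<Sum>\<^sub>\<infinity>C\<in>cosets.
        cnj (cnj (char_mat chi (coset_rep C)) * ?t (bottom_row (matrix_inv \<rho> ** coset_rep C ** mat 1))))"
      unfolding eisenstein_def coset_sum_def coset_rep_def[symmetric]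
    proof (rule infsum_cong)
      fix C assume C: "C \<in> cosets"
      have "matrix_inv \<rho> ** coset_rep C \<in> SL2Z"
        using \<rho> coset_rep(1)[OF \<rho> C] by (simp add: SL2Z_mult SL2Z_matrix_inv Gamma0_SL2Z)
      from t[OF this] show "cnj (char_mat (\<lambda>n. cnj (chi n)) (coset_rep C))
            * aut_factor (matrix_inv \<rho> ** coset_rep C) \<tau> powi (- (2 - k))
          = cnj (cnj (char_mat chi (coset_rep C)) * ?t (bottom_row (matrix_inv \<rho> ** coset_rep C ** mat 1)))"
        by (simp add: char_mat_def)
    qed
  then show ?thesis 
    unfolding infsum_cnj lattice_sum_def
    by (simp only: coset_sum_eq_lattice_sum[OF \<rho> one, where t = ?t and c = "\<lambda>g. cnj (char_mat chi g)"])
qed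

text \<open>Writing \<open>T\<^sub>p = S(p,0,0,m+2)\<close>, the lattice sum identities give \<open>(\<partial>\<^sub>u + i \<partial>\<^sub>v) F = i T\<^sub>m\<close> and
  \<open>(\<partial>\<^sub>u\<^sup>2 + \<partial>\<^sub>v\<^sup>2) F = m T\<^bsub>m-1\<^esub>\<close>. With \<open>k = - m\<close> and \<open>v T\<^bsub>m-1\<^esub> = T\<^sub>m\<close> the two parts of the Laplacian
  cancel. The conjugate of \<open>T\<^sub>m\<close> is \<open>v\<^sup>m\<close> times the Eisenstein series, which is the shadow.\<close>

lemma F_series_harmonic:
  shows "smooth_on upper_half_plane (F_series k N chi \<rho>)"
    and "\<tau> \<in> upper_half_plane \<Longrightarrow> hyp_laplacian k (F_series k N chi \<rho>) \<tau> = 0"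
    and "\<tau> \<in> upper_half_plane \<Longrightarrow>
      shadow k (F_series k N chi \<rho>) \<tau> = eisenstein (2 - k) N (\<lambda>n. cnj (chi n)) \<rho> \<tau>"
proof -
  define F c where "F = F_series k N chi \<rho>" and "c = 1 / complex_of_nat (Suc m)"
  define a where "a = F_coeff (mat 1)"
  have a: "norm (a x) \<le> 1" for x unfolding a_def by (rule norm_F_coeff_le)
  define S where "S = lattice_sum a (Suc m) 0 1 (Suc m)"
  have F: "F \<tau> = c * S \<tau>" if "\<tau> \<in> upper_half_plane" for \<tau>
    using F_series_eq_lattice_sum[OF that] by (simp add: F_def c_def S_def a_def)
  have c: "c * of_nat (Suc m) = 1" by (simp add: c_def del: of_nat_Suc)
  note H = open_upper_half_plane
  have smooth: "Ck_on n upper_half_plane S" for n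
    using smooth_on_lattice_sum[OF a weight_ge(2), where p = "Suc m" and q = 0 and r = 1 and s = "Suc m"]
    by (simp add: smooth_on_def S_def)
  show "smooth_on upper_half_plane (F_series k N chi \<rho>)"
    unfolding smooth_on_def F_def[symmetric]
    by (intro allI Ck_on_cong[OF H F] Ck_on_cmult[OF H] smooth)
  have diff: "S differentiable (at \<tau>)" "du S differentiable (at \<tau>)" "dv S differentiable (at \<tau>)"
    if "\<tau> \<in> upper_half_plane" for \<tau>
    using smooth[of "Suc (Suc 0)"] that by simp_all
  have d1: "du F \<tau> = c * du S \<tau>" "dv F \<tau> = c * dv S \<tau>" if \<tau>: "\<tau> \<in> upper_half_plane" for \<tau>
    using du_dv_cong[OF H \<tau> F] du_dv_cmult[OF diff(1)[OF \<tau>], of c] diff(1)[OF \<tau>] by simp_all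
  have d2: "du (du F) \<tau> = c * du (du S) \<tau>" "dv (dv F) \<tau> = c * dv (dv S) \<tau>" if \<tau>: "\<tau> \<in> upper_half_plane" for \<tau>
    using du_dv_cong(1)[OF H \<tau> d1(1)] du_dv_cong(2)[OF H \<tau> d1(2)]
      du_dv_cmult(1)[OF diff(2)[OF \<tau>], of c] du_dv_cmult(2)[OF diff(3)[OF \<tau>], of c] diff[OF \<tau>] by simp_all
  have dbar: "du F \<tau> + \<i> * dv F \<tau> = \<i> * lattice_sum a m 0 0 (Suc (Suc m)) \<tau>"
    if \<tau>: "\<tau> \<in> upper_half_plane" for \<tau>
  proof -
    have "du F \<tau> + \<i> * dv F \<tau> = c * (du S \<tau> + \<i> * dv S \<tau>)" by (simp add: d1[OF \<tau>] algebra_simps)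
    also have "\<dots> = (c * of_nat (Suc m)) * (\<i> * lattice_sum a m 0 0 (Suc (Suc m)) \<tau>)"
      unfolding S_def du_dv_maass_lattice_sum[OF a weight_ge(2) \<tau> refl] by (simp only: mult_ac)
    finally show ?thesis by (simp only: c mult_1)
  qed
  have v_power: "of_real (Im \<tau> ^ n) * lattice_sum a p 0 r s \<tau> = lattice_sum a (p + n) 0 r s \<tau>" for n p r s \<tau>
    by (induction n) (simp_all add: lattice_sum_mult_Im[symmetric] mult_ac)
  show "hyp_laplacian k (F_series k N chi \<rho>) \<tau> = 0" if \<tau>: "\<tau> \<in> upper_half_plane"
  proof -
    define T where "T n = lattice_sum a n 0 0 (Suc (Suc m)) \<tau>" for n
    have "du (du F) \<tau> + dv (dv F) \<tau> = c * (du (du S) \<tau> + dv (dv S) \<tau>)" by (simp add: d2[OF \<tau>] algebra_simps)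
    also have "\<dots> = (c * of_nat (Suc m)) * (of_nat m * T (m - 1))"
      unfolding S_def laplacian_maass_lattice_sum[OF a weight_ge(2) \<tau> refl] T_def by (simp only: mult_ac)
    finally have lap: "du (du F) \<tau> + dv (dv F) \<tau> = of_nat m * T (m - 1)" by (simp only: c mult_1)
    have v: "of_real (Im \<tau>) * T (m - 1) = T m"
      using v_power[of \<tau> 1 "m - 1" 0 "Suc (Suc m)"] weight_ge(1) by (simp add: T_def)
    have "hyp_laplacian k F \<tau> = - of_real ((Im \<tau>)\<^sup>2) * (of_nat m * T (m - 1))
        + \<i> * of_int k * of_real (Im \<tau>) * (\<i> * T m)"
      unfolding hyp_laplacian_def lap dbar[OF \<tau>] T_def ..
    also have "\<dots> = of_nat m * of_real (Im \<tau>) * (T m - of_real (Im \<tau>) * T (m - 1))"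
      by (simp add: k(1) algebra_simps power2_eq_square)
    also have "\<dots> = 0" unfolding v by simp
    finally show ?thesis by (simp add: F_def)
  qed
  show "shadow k (F_series k N chi \<rho>) \<tau> = eisenstein (2 - k) N (\<lambda>n. cnj (chi n)) \<rho> \<tau>" if \<tau>: "\<tau> \<in> upper_half_plane"
  proof -
    have v: "Im \<tau> \<noteq> 0" using \<tau> by (simp add: upper_half_plane_def)
    have vm: "lattice_sum a m 0 0 (Suc (Suc m)) \<tau> = of_real (Im \<tau> ^ m) * lattice_sum a 0 0 0 (Suc (Suc m)) \<tau>"
      using v_power[of \<tau> m 0 0 "Suc (Suc m)"] by simp
    have "shadow k F \<tau> = of_real (Im \<tau> powi k) * cnj (lattice_sum a m 0 0 (Suc (Suc m)) \<tau>)"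
      unfolding shadow_def d_taubar_def dbar[OF \<tau>] by (simp add: complex_eq_iff)
    also have "\<dots> = of_real (Im \<tau> powi k * Im \<tau> ^ m) * cnj (lattice_sum a 0 0 0 (Suc (Suc m)) \<tau>)"
      unfolding vm by (simp add: mult_ac)
    also have "Im \<tau> powi k * Im \<tau> ^ m = 1" using v by (simp add: k(1) power_int_minus)
    finally show ?thesis by (simp add: F_def eisenstein_eq_lattice_sum a_def)
  qed
qed

end

theorem theorem3p4:
  fixes k :: int and N :: nat and chi :: "int \<Rightarrow> complex"
    and \<rho> :: cusp and \<gamma>\<^sub>\<rho> :: "rat^2^2"
  assumes "k < 0"
    and "N \<ge> 1"
    and "dirichlet_character N chi"
    and "chi (-1) = (-1) powi k"
    and "\<gamma>\<^sub>\<rho> \<in> SL2Z"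
    and "cusp_action \<gamma>\<^sub>\<rho> Infinity_cusp = \<rho>"
    and "\<forall>g\<in>Gamma_cusp N \<gamma>\<^sub>\<rho>. char_mat chi g = 1"
  shows "F_series k N chi \<gamma>\<^sub>\<rho> \<in> harmonic_maass k N chi
    \<and> poly_growth_at_cusps k (F_series k N chi \<gamma>\<^sub>\<rho>)
    \<and> F_series k N chi \<gamma>\<^sub>\<rho> \<in> harmonic_maass_sharp k N chi
    \<and> (\<forall>\<tau>\<in>upper_half_plane.
          shadow k (F_series k N chi \<gamma>\<^sub>\<rho>) \<tau> = eisenstein (2 - k) N (\<lambda>n. cnj (chi n)) \<gamma>\<^sub>\<rho> \<tau>)"
proof -
  define m where "m = nat (- k)"
  have k: "k = - int m" using assms(1) by (simp add: m_def)
  \<comment> \<open>Minus the identity lies in the stabiliser of every cusp, and this forces an even weight.\<close>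
  have "char_mat chi (mat (-1)) = 1" using assms(7) mat_in_Gamma_cusp(2)[OF assms(5)] by blast
  moreover have "\<lfloor>- 1 :: rat\<rfloor> = - 1" by (simp add: floor_eq_iff)
  ultimately have "(-1 :: complex) powi k = 1" using assms(4) by (simp add: char_mat_def mat_def)
  then have "even k" by (cases "even k") (auto simp: power_int_minus_left)
  note F = assms(2,3,5) assms(7)[rule_format] k \<open>even k\<close> assms(1)
  have poly: "poly_growth_at_cusps k (F_series k N chi \<gamma>\<^sub>\<rho>)"
    unfolding poly_growth_at_cusps_def
    using poly_growth_F_series[OF F] of_nat_0_le_iff by blast
  have "F_series k N chi \<gamma>\<^sub>\<rho> \<in> harmonic_maass k N chi"
    unfolding harmonic_maass_def
    using F_series_harmonic(1,2)[OF F] F_series_modular[OF F] exp_growth_F_series[OF F] zero_less_one by blast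
  then show ?thesis
    using poly F_series_harmonic(3)[OF F] by (simp add: harmonic_maass_sharp_def)
qed

end
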